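(* For functions $F$ from the c.e. subsets of $\mathbb{N}$ (the computable points of $\mathcal{P}(\mathbb{N})$) to $\mathcal{O}(\mathbb{B})$: every Type-2-computable such function is K-computable and every K-computable one is Markov-computable; there exists such a function that is Markov-computable but not K-computable; and there exists such a function that is K-computable but not Type-2-computable.
   Context: Let $(D_i)$ be the canonical enumeration of finite subsets of $\mathbb{N}$; $\mathcal{P}(\mathbb{N})$ carries the Scott topology with basis $[D_i]=\{X:D_i\subseteq X\}$. A Type-2 name of $W\subseteq\mathbb{N}$ is any $p\in\mathbb{N}^{\mathbb{N}}$ with $\{p(n)\}=\{i:D_i\subseteq W\}$; points with computable names are exactly the c.e. sets. A Markov name of a c.e. set $E$ is an index $e$ such that $\varphi_e$ is total and a Type-2 name of $E$; $K(E)$ is the length of a shortest program computing a Type-2 name of $E$; a K-name of $E$ is a pair $(k,p)$ with $k\geq K(E)$ and $p$ a Type-2 name of $E$. $\mathbb{B}=\mathbb{N}^{\mathbb{N}}$ is Baire space and $\mathcal{O}(\mathbb{B})$ its set of open subsets; an $\mathcal{O}(\mathbb{B})$-name of an open set $U$ is an enumeration, on a one-way output tape, of a set of finite sequences $u$ whose cylinders $[u]$ have union $U$. For R $\in\{$Type-2, Markov, K$\}$, $F$ is R-computable if a Turing machine, given any R-name of any c.e. set $E$, outputs an $\mathcal{O}(\mathbb{B})$-name of $F(E)$. *)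

theory Defs
  imports
    "HOL-Library.Nat_Bijection"
    "HOL-Library.Discrete_Functions"
    "HOL-Library.FuncSet"
    "HOL-Analysis.Function_Topology"
begin

section \<open>Turing machines with an infinite input tape and a one-way output tape\<close>

text \<open>
  Type-2 Turing machines in flowchart form: a one-way read-only input tape over \<open>{0, 1}\<close>,
  two-way infinite work tapes (initially all \<open>0\<close>, the blank), and a one-way write-only output
  tape over \<open>{0, 1}\<close>; the bits are rendered as booleans.  A program is a finite list of
  instructions, so it mentions only finitely many work tapes and work symbols.  Jumps go to an
  absolute position of the program; leaving the program means halting.
\<close>

datatype instr =
    Input_Right
  | If_Input nat          \<comment> \<open>jump if the scanned input symbol is \<open>1\<close>\<close>
  | Left nat
  | Right nat
  | Write nat nat         \<comment> \<open>work tape, symbol\<close>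
  | If_Work nat nat nat   \<comment> \<open>work tape, symbol, jump target\<close>
  | Output bool

record config =
  pc :: nat
  in_pos :: nat
  head :: "nat \<Rightarrow> int"
  work :: "nat \<Rightarrow> int \<Rightarrow> nat"
  out :: "bool list"

definition init :: config where
  "init = \<lparr>pc = 0, in_pos = 0, head = (\<lambda>_. 0), work = (\<lambda>_ _. 0), out = []\<rparr>"

fun exec :: "(nat \<Rightarrow> bool) \<Rightarrow> instr \<Rightarrow> config \<Rightarrow> config" where
  "exec x Input_Right c = c\<lparr>pc := Suc (pc c), in_pos := Suc (in_pos c)\<rparr>"
| "exec x (If_Input l) c = c\<lparr>pc := (if x (in_pos c) then l else Suc (pc c))\<rparr>"
| "exec x (Left i) c = c\<lparr>pc := Suc (pc c), head := (head c)(i := head c i - 1)\<rparr>"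
| "exec x (Right i) c = c\<lparr>pc := Suc (pc c), head := (head c)(i := head c i + 1)\<rparr>"
| "exec x (Write i s) c =
     c\<lparr>pc := Suc (pc c), work := (work c)(i := (work c i)(head c i := s))\<rparr>"
| "exec x (If_Work i s l) c = c\<lparr>pc := (if work c i (head c i) = s then l else Suc (pc c))\<rparr>"
| "exec x (Output b) c = c\<lparr>pc := Suc (pc c), out := out c @ [b]\<rparr>"

definition halted :: "instr list \<Rightarrow> config \<Rightarrow> bool" where
  "halted P c \<longleftrightarrow> length P \<le> pc c"

definition step :: "instr list \<Rightarrow> (nat \<Rightarrow> bool) \<Rightarrow> config \<Rightarrow> config" where
  "step P x c = (if halted P c then c else exec x (P ! pc c) c)"

text \<open>Sequences of numbers are written on tapes in unary, \<open>p\<close> as \<open>1\<^sup>p\<^sup>(\<^sup>0\<^sup>) 0 1\<^sup>p\<^sup>(\<^sup>1\<^sup>) 0 \<dots>\<close>;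
  the separators \<open>0\<close> sit at the positions \<open>(p 0 + 1) + \<dots> + (p k + 1) - 1\<close>.\<close>

definition unary :: "nat \<Rightarrow> bool list" where
  "unary m = replicate m True @ [False]"

definition input_tape :: "(nat \<Rightarrow> nat) \<Rightarrow> nat \<Rightarrow> bool" where
  "input_tape p n \<longleftrightarrow> \<not> (\<exists>k. Suc n = (\<Sum>i\<le>k. Suc (p i)))"

definition run :: "instr list \<Rightarrow> (nat \<Rightarrow> nat) \<Rightarrow> nat \<Rightarrow> config" where
  "run P p t = (step P (input_tape p) ^^ t) init"

text \<open>The numbers completely written on the output tape at some time; the machine need not
  halt, and there may be finitely many of them, or none.\<close>

definition enumerated :: "instr list \<Rightarrow> (nat \<Rightarrow> nat) \<Rightarrow> nat set" where
  "enumerated P p =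
     {m. \<exists>t ms r. out (run P p t) = concat (map unary ms) @ unary m @ r}"


section \<open>The numbering of the partial computable functions\<close>

text \<open>Superfluous components of the code of an instruction are ignored.\<close>

definition decode_instr :: "nat \<Rightarrow> instr" where
  "decode_instr n =
     (let (k, x) = prod_decode n; (i, y) = prod_decode x; (s, l) = prod_decode y in
      if k = 0 then Input_Right
      else if k = 1 then If_Input l
      else if k = 2 then Left i
      else if k = 3 then Right i
      else if k = 4 then Write i s
      else if k = 5 then If_Work i s l
      else Output (s \<noteq> 0))"

definition program :: "nat \<Rightarrow> instr list" where
  "program e = map decode_instr (list_decode e)"

lemma surj_decode_instr: "surj decode_instr"
proof (rule surjI)
  define enc where "enc k i s l = prod_encode (k, prod_encode (i, prod_encode (s, l)))"
    for k i s l :: nat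
  define f where "f I = (case I of Input_Right \<Rightarrow> enc 0 0 0 0 | If_Input l \<Rightarrow> enc 1 0 0 l
    | Left i \<Rightarrow> enc 2 i 0 0 | Right i \<Rightarrow> enc 3 i 0 0 | Write i s \<Rightarrow> enc 4 i s 0
    | If_Work i s l \<Rightarrow> enc 5 i s l | Output b \<Rightarrow> enc 6 0 (of_bool b) 0)" for I
  show "decode_instr (f I) = I" for I
    by (cases I) (simp_all add: f_def enc_def decode_instr_def)
qed

lemma surj_program: "surj program"
proof (rule surjI)
  show "program (list_encode (map (inv decode_instr) P)) = P" for P
    by (simp add: program_def o_def surj_f_inv_f[OF surj_decode_instr])
qed

text \<open>A number \<open>n\<close> is given as input in the form \<open>1\<^sup>n 0 0 0 \<dots>\<close>.\<close>

definition input_nat :: "nat \<Rightarrow> nat \<Rightarrow> nat" where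
  "input_nat n = case_nat n (\<lambda>_. 0)"

definition phi :: "nat \<Rightarrow> nat \<rightharpoonup> nat" where
  "phi e n =
     (let result = (\<lambda>m. \<exists>t. halted (program e) (run (program e) (input_nat n) t) \<and>
                            out (run (program e) (input_nat n) t) = unary m)
      in if \<exists>m. result m then Some (THE m. result m) else None)"

definition ce :: "nat set \<Rightarrow> bool" where
  "ce E \<longleftrightarrow> (\<exists>e. E = dom (phi e))"

text \<open>The program \<open>e\<close> is identified with the \<open>e\<close>-th binary string in length-lexicographic
  order, i.e. the binary expansion of \<open>e + 1\<close> without its leading \<open>1\<close>.\<close>

definition program_length :: "nat \<Rightarrow> nat" where
  "program_length e = floor_log (Suc e)"


section \<open>Names\<close>

text \<open>\<^const>\<open>set_decode\<close> is the canonical enumeration of the finite sets of numbers.\<close>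

definition type2_name :: "(nat \<Rightarrow> nat) \<Rightarrow> nat set \<Rightarrow> bool" where
  "type2_name p W \<longleftrightarrow> range p = {i. set_decode i \<subseteq> W}"

definition markov_name :: "nat \<Rightarrow> nat set \<Rightarrow> bool" where
  "markov_name e E \<longleftrightarrow> (\<exists>p. (\<forall>n. phi e n = Some (p n)) \<and> type2_name p E)"

definition K :: "nat set \<Rightarrow> nat" where
  "K E = (LEAST k. \<exists>e. markov_name e E \<and> k = program_length e)"

definition K_name :: "nat \<times> (nat \<Rightarrow> nat) \<Rightarrow> nat set \<Rightarrow> bool" where
  "K_name = (\<lambda>(k, p) E. K E \<le> k \<and> type2_name p E)"

definition cylinder :: "nat list \<Rightarrow> (nat \<Rightarrow> nat) set" where
  "cylinder u = {f. \<forall>i<length u. f i = u ! i}"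

text \<open>Finite sequences are output through their codes under \<^const>\<open>list_encode\<close>.\<close>

definition outputs_open_name :: "instr list \<Rightarrow> (nat \<Rightarrow> nat) \<Rightarrow> (nat \<Rightarrow> nat) set \<Rightarrow> bool" where
  "outputs_open_name P p U \<longleftrightarrow> (\<Union>m\<in>enumerated P p. cylinder (list_decode m)) = U"


section \<open>Computable functions from c.e. sets to open subsets of Baire space\<close>

definition type2_computable :: "(nat set \<Rightarrow> (nat \<Rightarrow> nat) set) \<Rightarrow> bool" where
  "type2_computable F \<longleftrightarrow>
     (\<exists>P. \<forall>E p. ce E \<longrightarrow> type2_name p E \<longrightarrow> outputs_open_name P p (F E))"

definition markov_computable :: "(nat set \<Rightarrow> (nat \<Rightarrow> nat) set) \<Rightarrow> bool" where
  "markov_computable F \<longleftrightarrow>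
     (\<exists>P. \<forall>E e. ce E \<longrightarrow> markov_name e E \<longrightarrow> outputs_open_name P (input_nat e) (F E))"

text \<open>The pair \<open>(k, p)\<close> is given as the sequence \<open>k, p 0, p 1, \<dots>\<close>.\<close>

definition K_computable :: "(nat set \<Rightarrow> (nat \<Rightarrow> nat) set) \<Rightarrow> bool" where
  "K_computable F \<longleftrightarrow>
     (\<exists>P. \<forall>E k p. ce E \<longrightarrow> K_name (k, p) E \<longrightarrow> outputs_open_name P (case_nat k p) (F E))"

end

theory Submission
  imports Defs
begin

text \<open>
  The inclusions need a simulation: a name of a c.e. set computed by program \<open>e\<close> can be produced
  by running \<open>e\<close>, and \<open>e\<close> itself is an upper bound for the length of \<open>e\<close>.

  Markov but not K: let \<open>C\<close> be the closed set of all \<open>f\<close> such that \<open>f e\<close> bounds the time at which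
  program \<open>e\<close> shows that \<open>0\<close> is in the set it names, whenever this happens, and let \<open>F E\<close> be the
  complement of \<open>C\<close> if \<open>0 \<in> E\<close> and everything otherwise.  Given \<open>e\<close>, one may accept \<open>f\<close> as soon as
  \<open>0\<close> has not shown up by time \<open>f e\<close>.  For a fixed \<open>k\<close>, however, a K-computable function is monotone
  on the sets of complexity at most \<open>k\<close>, and \<open>F {} \<subseteq> F {0}\<close> fails.

  K but not Type-2: let \<open>C\<close> be the closed set of all \<open>f\<close> which provide, for each program \<open>e\<close>, either
  an element missing from the set named by \<open>e\<close> or evidence that this set is \<open>\<nat>\<close>, and let \<open>F E\<close> be
  everything if \<open>E = \<nat>\<close> and the complement of \<open>C\<close> otherwise.  Knowing \<open>k \<ge> K(E)\<close>, one may accept \<open>f\<close>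
  as soon as \<open>E\<close> has enumerated all the elements which \<open>f\<close> claims to be missing from the sets named by
  the finitely many programs of length at most \<open>k\<close>.  But \<open>F \<nat>\<close> is not the union of the \<open>F D\<close> over
  finite \<open>D\<close>.
\<close>

section \<open>Primitive recursive functions\<close>

abbreviation p1 :: "nat \<Rightarrow> nat" where "p1 n \<equiv> fst (prod_decode n)"
abbreviation p2 :: "nat \<Rightarrow> nat" where "p2 n \<equiv> snd (prod_decode n)"

text \<open>Unary form of primitive recursion: several arguments are packed by
  \<open>prod_encode\<close>, and iteration of a function on a start value replaces recursion. This
  leaves few cases for the translation into counter programs.\<close>

inductive prim_rec :: "(nat \<Rightarrow> nat) \<Rightarrow> bool" where
  zero: "prim_rec (\<lambda>_. 0)"
| suc: "prim_rec Suc"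
| fst: "prim_rec p1"
| snd: "prim_rec p2"
| comp: "prim_rec f \<Longrightarrow> prim_rec g \<Longrightarrow> prim_rec (\<lambda>x. f (g x))"
| pair: "prim_rec f \<Longrightarrow> prim_rec g \<Longrightarrow> prim_rec (\<lambda>x. prod_encode (f x, g x))"
| iter: "prim_rec f \<Longrightarrow> prim_rec (\<lambda>x. (f ^^ p2 x) (p1 x))"

lemma prim_rec_id: "prim_rec (\<lambda>x. x)"
  using prim_rec.pair[OF prim_rec.fst prim_rec.snd] by simp

lemma prim_rec_Suc: "prim_rec f \<Longrightarrow> prim_rec (\<lambda>x. Suc (f x))"
  by (rule prim_rec.comp[OF prim_rec.suc])

lemma prim_rec_const: "prim_rec (\<lambda>_. n)"
  by (induction n) (auto intro: prim_rec.zero prim_rec_Suc)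

lemma prim_rec_p1: "prim_rec f \<Longrightarrow> prim_rec (\<lambda>x. p1 (f x))"
  by (rule prim_rec.comp[OF prim_rec.fst])

lemma prim_rec_p2: "prim_rec f \<Longrightarrow> prim_rec (\<lambda>x. p2 (f x))"
  by (rule prim_rec.comp[OF prim_rec.snd])

lemmas prim_rec_basic = prim_rec_id prim_rec_const prim_rec_Suc prim_rec_p1 prim_rec_p2 prim_rec.pair

lemma prim_rec_comp2:
  assumes "prim_rec (\<lambda>z. f (p1 z) (p2 z))" "prim_rec a" "prim_rec b"
  shows "prim_rec (\<lambda>x. f (a x) (b x))"
  using prim_rec.comp[OF assms(1) prim_rec.pair[OF assms(2,3)]] by simp

lemma prim_rec_comp3:
  assumes "prim_rec (\<lambda>z. f (p1 z) (p1 (p2 z)) (p2 (p2 z)))" "prim_rec a" "prim_rec b" "prim_rec c"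
  shows "prim_rec (\<lambda>x. f (a x) (b x) (c x))"
  using prim_rec.comp[OF assms(1) prim_rec.pair[OF assms(2) prim_rec.pair[OF assms(3,4)]]] by simp

text \<open>Recursion is iteration on triples \<open>(x, k, a)\<close>, which carry the parameter
  and the stage along with the value.\<close>

lemma prim_rec_rec:
  assumes "prim_rec f" "prim_rec n" "prim_rec (\<lambda>z. g (p1 z) (p1 (p2 z)) (p2 (p2 z)))"
  shows "prim_rec (\<lambda>x. rec_nat (f x) (g x) (n x))"
proof -
  define h where "h z = prod_encode (p1 z, prod_encode (Suc (p1 (p2 z)),
    g (p1 z) (p1 (p2 z)) (p2 (p2 z))))" for z
  have h: "prim_rec h"
    unfolding h_def by (intro prim_rec_basic assms)
  have step: "(h ^^ k) (prod_encode (x, prod_encode (0, a))) =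
      prod_encode (x, prod_encode (k, rec_nat a (g x) k))" for x a k
    by (induction k) (simp_all add: h_def)
  have "prim_rec (\<lambda>x. (h ^^ n x) (prod_encode (x, prod_encode (0, f x))))"
    using prim_rec.comp[OF prim_rec.iter[OF h],
        of "\<lambda>x. prod_encode (prod_encode (x, prod_encode (0, f x)), n x)"]
    by (simp add: prim_rec_basic assms)
  then have "prim_rec (\<lambda>x. p2 (p2 ((h ^^ n x) (prod_encode (x, prod_encode (0, f x))))))"
    by (intro prim_rec_basic)
  then show ?thesis
    by (simp add: step)
qed

lemma prim_rec_funpow:
  assumes "prim_rec f" "prim_rec n" "prim_rec (\<lambda>z. g (p1 z) (p2 z))"
  shows "prim_rec (\<lambda>x. (g x ^^ n x) (f x))"
proof -
  have "rec_nat a (\<lambda>_. g x) k = (g x ^^ k) a" for a x k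
    by (induction k) simp_all
  moreover have "prim_rec (\<lambda>x. rec_nat (f x) (\<lambda>_. g x) (n x))"
    using prim_rec.comp[OF assms(3), of "\<lambda>z. prod_encode (p1 z, p2 (p2 z))"]
    by (intro prim_rec_rec assms) (simp add: prim_rec_basic)
  ultimately show ?thesis by simp
qed

section \<open>Arithmetic and bounded sums\<close>

lemma prim_rec_minus_1:
  assumes "prim_rec f" shows "prim_rec (\<lambda>x. f x - 1)"
proof -
  have "rec_nat 0 (\<lambda>k _. k) n = n - 1" for n :: nat
    by (cases n) simp_all
  moreover have "prim_rec (\<lambda>x. rec_nat 0 (\<lambda>k _. k) (f x))"
    by (intro prim_rec_rec prim_rec_basic assms)
  ultimately show ?thesis by simp
qed

lemma prim_rec_add:
  assumes "prim_rec f" "prim_rec g" shows "prim_rec (\<lambda>x. f x + g x)"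
proof -
  have "prim_rec (\<lambda>x. (Suc ^^ f x) (g x))"
    by (intro prim_rec_funpow prim_rec_basic assms)
  then show ?thesis by simp
qed

lemma prim_rec_diff:
  assumes "prim_rec f" "prim_rec g" shows "prim_rec (\<lambda>x. f x - g x)"
proof -
  have "((\<lambda>k. k - 1) ^^ n) m = m - n" for m n :: nat
    by (induction n) simp_all
  moreover have "prim_rec (\<lambda>x. ((\<lambda>k. k - 1) ^^ g x) (f x))"
    by (intro prim_rec_funpow prim_rec_minus_1 prim_rec_basic assms)
  ultimately show ?thesis by simp
qed

lemma prim_rec_sum:
  assumes "prim_rec n" "prim_rec (\<lambda>z. f (p1 z) (p2 z))"
  shows "prim_rec (\<lambda>x. \<Sum>i<n x. f x i)"
proof -
  have "rec_nat 0 (\<lambda>k a. a + f x k) m = (\<Sum>i<m. f x i)" for x m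
    by (induction m) simp_all
  moreover have "prim_rec (\<lambda>x. rec_nat 0 (\<lambda>k a. a + f x k) (n x))"
    using prim_rec.comp[OF assms(2), of "\<lambda>z. prod_encode (p1 z, p1 (p2 z))"]
    by (intro prim_rec_rec prim_rec_add prim_rec_basic assms) (simp add: prim_rec_basic)
  ultimately show ?thesis by simp
qed

section \<open>Decidable predicates and bounded quantifiers\<close>

abbreviation prim_rec_predicate :: "(nat \<Rightarrow> bool) \<Rightarrow> bool" where
  "prim_rec_predicate P \<equiv> prim_rec (\<lambda>x. of_bool (P x))"

lemma prim_rec_if:
  assumes "prim_rec_predicate P" "prim_rec f" "prim_rec g"
  shows "prim_rec (\<lambda>x. if P x then f x else g x)"
proof -
  have "prim_rec (\<lambda>x. rec_nat (g x) (\<lambda>_ _. f x) (of_bool (P x)))"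
    using prim_rec.comp[OF assms(2) prim_rec.fst] by (intro prim_rec_rec assms)
  moreover have "rec_nat (g x) (\<lambda>_ _. f x) (of_bool (P x)) = (if P x then f x else g x)" for x
    by simp
  ultimately show ?thesis by simp
qed

lemma prim_rec_neq_0:
  assumes "prim_rec f" shows "prim_rec_predicate (\<lambda>x. f x \<noteq> 0)"
proof -
  have "prim_rec (\<lambda>x. rec_nat 0 (\<lambda>_ _. 1) (f x))"
    by (intro prim_rec_rec prim_rec_basic assms)
  moreover have "rec_nat 0 (\<lambda>_ _. 1) n = (of_bool (n \<noteq> 0) :: nat)" for n :: nat
    by (cases n) simp_all
  ultimately show ?thesis by simp
qed

lemma prim_rec_not:
  assumes "prim_rec_predicate P" shows "prim_rec_predicate (\<lambda>x. \<not> P x)"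
proof -
  have "prim_rec (\<lambda>x. 1 - of_bool (P x))"
    by (intro prim_rec_diff prim_rec_basic assms)
  moreover have "1 - of_bool (P x) = (of_bool (\<not> P x) :: nat)" for x
    by simp
  ultimately show ?thesis by simp
qed

lemma prim_rec_conj:
  assumes "prim_rec_predicate P" "prim_rec_predicate Q"
  shows "prim_rec_predicate (\<lambda>x. P x \<and> Q x)"
proof -
  have "prim_rec (\<lambda>x. if P x then of_bool (Q x) else 0)"
    by (intro prim_rec_if prim_rec_basic assms)
  moreover have "(if P x then of_bool (Q x) else 0) = (of_bool (P x \<and> Q x) :: nat)" for x
    by simp
  ultimately show ?thesis by simp
qed

lemma prim_rec_disj:
  assumes "prim_rec_predicate P" "prim_rec_predicate Q"
  shows "prim_rec_predicate (\<lambda>x. P x \<or> Q x)"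
  using prim_rec_not[OF prim_rec_conj[OF prim_rec_not prim_rec_not, OF assms]] by simp

lemma prim_rec_imp:
  assumes "prim_rec_predicate P" "prim_rec_predicate Q"
  shows "prim_rec_predicate (\<lambda>x. P x \<longrightarrow> Q x)"
  using prim_rec_disj[OF prim_rec_not[OF assms(1)] assms(2)] by (simp only: imp_conv_disj)

lemma prim_rec_less:
  assumes "prim_rec f" "prim_rec g" shows "prim_rec_predicate (\<lambda>x. f x < g x)"
  using prim_rec_neq_0[OF prim_rec_diff[OF assms(2,1)]] by (simp add: not_le)

lemma prim_rec_le:
  assumes "prim_rec f" "prim_rec g" shows "prim_rec_predicate (\<lambda>x. f x \<le> g x)"
  using prim_rec_not[OF prim_rec_less[OF assms(2,1)]] by (simp only: not_less)

lemma prim_rec_eq: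
  assumes "prim_rec f" "prim_rec g" shows "prim_rec_predicate (\<lambda>x. f x = g x)"
  using prim_rec_conj[OF prim_rec_le[OF assms] prim_rec_le[OF assms(2,1)]]
  by (simp only: order_eq_iff)

text \<open>The bounded sum of the truth values counts the witnesses, so it is nonzero exactly if
  there is one.\<close>

lemma prim_rec_bex:
  assumes "prim_rec n" "prim_rec_predicate (\<lambda>z. P (p1 z) (p2 z))"
  shows "prim_rec_predicate (\<lambda>x. \<exists>i<n x. P x i)"
proof -
  have "prim_rec_predicate (\<lambda>x. (\<Sum>i<n x. of_bool (P x i) :: nat) \<noteq> 0)"
    by (intro prim_rec_neq_0 prim_rec_sum assms)
  moreover have "(\<Sum>i<n x. of_bool (P x i) :: nat) \<noteq> 0 \<longleftrightarrow> (\<exists>i<n x. P x i)" for x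
    by (subst sum_eq_0_iff) auto
  ultimately show ?thesis by simp
qed

lemma prim_rec_ball:
  assumes "prim_rec n" "prim_rec_predicate (\<lambda>z. P (p1 z) (p2 z))"
  shows "prim_rec_predicate (\<lambda>x. \<forall>i<n x. P x i)"
  using prim_rec_not[OF prim_rec_bex[OF assms(1) prim_rec_not[OF assms(2)]]] by simp

lemmas prim_rec_logic = prim_rec_basic prim_rec_minus_1 prim_rec_add prim_rec_diff prim_rec_if
  prim_rec_neq_0 prim_rec_not prim_rec_conj prim_rec_disj prim_rec_imp prim_rec_less prim_rec_le
  prim_rec_eq prim_rec_bex prim_rec_ball

section \<open>Powers of two and binary digits\<close>

lemma prim_rec_double: "prim_rec f \<Longrightarrow> prim_rec (\<lambda>x. 2 * f x)"
  by (subst mult_2) (intro prim_rec_logic)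

lemma prim_rec_power2:
  assumes "prim_rec f" shows "prim_rec (\<lambda>x. 2 ^ f x)"
proof -
  have "((*) 2 ^^ n) 1 = (2 ^ n :: nat)" for n
    by (induction n) simp_all
  moreover have "prim_rec (\<lambda>x. ((*) 2 ^^ f x) 1)"
    by (intro prim_rec_funpow prim_rec_double prim_rec_logic assms)
  ultimately show ?thesis by simp
qed

lemma prim_rec_even:
  assumes "prim_rec f" shows "prim_rec_predicate (\<lambda>x. even (f x))"
proof -
  have "even n \<longleftrightarrow> (\<exists>i<Suc n. n = 2 * i)" for n :: nat
    by auto
  then show ?thesis
    by (simp only:) (intro prim_rec_logic prim_rec_double prim_rec.comp[OF assms] assms)
qed

lemma prim_rec_div2:
  assumes "prim_rec f" shows "prim_rec (\<lambda>x. f x div 2)"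
proof -
  \<comment> \<open>Passing from \<open>k\<close> to \<open>k + 1\<close> raises the half exactly
    when \<open>k\<close> is odd.\<close>
  have "rec_nat 0 (\<lambda>k a. if even k then a else Suc a) n = n div 2" for n
    by (induction n) auto
  moreover have "prim_rec (\<lambda>x. rec_nat 0 (\<lambda>k a. if even k then a else Suc a) (f x))"
    by (intro prim_rec_rec prim_rec_even prim_rec_logic assms)
  ultimately show ?thesis by simp
qed

text \<open>\<open>set_decode n\<close> consists of the positions of ones in the binary expansion of
  \<open>n\<close>, so membership of \<open>m\<close> is oddness after \<open>m\<close>
  halvings.\<close>

lemma prim_rec_set_decode:
  assumes "prim_rec f" "prim_rec g" shows "prim_rec_predicate (\<lambda>x. f x \<in> set_decode (g x))"
proof -
  have "((\<lambda>k. k div 2) ^^ n) m = m div 2 ^ n" for m n :: nat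
    by (induction n) (simp_all add: power_Suc2 div_mult2_eq del: power_Suc)
  then have "m \<in> set_decode n \<longleftrightarrow> \<not> even (((\<lambda>k. k div 2) ^^ m) n)" for m n
    by (simp add: set_decode_def)
  then show ?thesis
    by (simp only:) (intro prim_rec_not prim_rec_even prim_rec_funpow prim_rec_div2 prim_rec_basic assms)
qed

section \<open>Lists\<close>

text \<open>Agrees with the code of a nonempty list under \<open>list_encode\<close>, so that
  \<open>list_decode\<close> reads these codes.\<close>

definition code_cons :: "nat \<Rightarrow> nat \<Rightarrow> nat" where
  "code_cons x l = Suc (prod_encode (x, l))"

text \<open>\<open>code_tl 0 = 0\<close> and \<open>code_nth l i = 0\<close> beyond the end of the list.\<close>

definition code_tl :: "nat \<Rightarrow> nat" where
  "code_tl l = p2 (l - 1)"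

definition code_drop :: "nat \<Rightarrow> nat \<Rightarrow> nat" where
  "code_drop n l = (code_tl ^^ n) l"

definition code_nth :: "nat \<Rightarrow> nat \<Rightarrow> nat" where
  "code_nth l i = p1 (code_drop i l - 1)"

text \<open>Together with \<open>0 - 1 = 0\<close>, this gives head and tail of the empty list the
  value \<open>0\<close>.\<close>

lemma prod_decode_0 [simp]: "prod_decode 0 = (0, 0)"
  by (simp add: prod_decode_def prod_decode_aux.simps)

lemma code_cons_list_encode [simp]: "code_cons x (list_encode xs) = list_encode (x # xs)"
  by (simp add: code_cons_def)

lemma list_decode_code_cons [simp]: "list_decode (code_cons x l) = x # list_decode l"
  by (simp add: code_cons_def)

lemma code_tl_list_encode: "code_tl (list_encode xs) = list_encode (tl xs)"
  by (cases xs) (simp_all add: code_tl_def)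

lemma code_drop_list_encode: "code_drop n (list_encode xs) = list_encode (drop n xs)"
  by (induction n) (simp_all add: code_drop_def code_tl_list_encode tl_drop drop_Suc)

lemma list_encode_eq_0 [simp]: "list_encode xs = 0 \<longleftrightarrow> xs = []"
  by (cases xs) simp_all

text \<open>Only the empty list has code \<open>0\<close>. This is the test for a position beyond
  the end of a list, later used to recognize halting.\<close>

lemma code_drop_eq_0: "code_drop n l = 0 \<longleftrightarrow> length (list_decode l) \<le> n"
  using code_drop_list_encode[of n "list_decode l"] by simp

lemma code_nth_list_encode:
  "code_nth (list_encode xs) i = (if i < length xs then xs ! i else 0)"
proof (cases "i < length xs")
  case True
  then obtain ys where "drop i xs = xs ! i # ys"
    by (metis Cons_nth_drop_Suc)
  then show ?thesis
    using True by (simp add: code_nth_def code_drop_list_encode)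
qed (simp add: code_nth_def code_drop_list_encode)

lemma code_nth_list_decode:
  "code_nth l i = (if i < length (list_decode l) then list_decode l ! i else 0)"
  using code_nth_list_encode[of "list_decode l"] by simp

lemma prim_rec_code_cons: "prim_rec f \<Longrightarrow> prim_rec g \<Longrightarrow> prim_rec (\<lambda>x. code_cons (f x) (g x))"
  unfolding code_cons_def by (intro prim_rec_basic)

lemma prim_rec_code_tl: "prim_rec f \<Longrightarrow> prim_rec (\<lambda>x. code_tl (f x))"
  unfolding code_tl_def by (intro prim_rec_logic)

lemma prim_rec_code_drop: "prim_rec f \<Longrightarrow> prim_rec g \<Longrightarrow> prim_rec (\<lambda>x. code_drop (f x) (g x))"
  unfolding code_drop_def by (intro prim_rec_funpow prim_rec_code_tl prim_rec_logic)

lemma prim_rec_code_nth: "prim_rec f \<Longrightarrow> prim_rec g \<Longrightarrow> prim_rec (\<lambda>x. code_nth (f x) (g x))"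
  unfolding code_nth_def by (intro prim_rec_code_drop prim_rec_logic)

lemma length_list_decode_le: "length (list_decode l) \<le> l"
proof -
  have "length xs \<le> list_encode xs" for xs
  proof (induction xs)
    case (Cons x xs)
    then show ?case
      using le_prod_encode_2[of "list_encode xs" x] by simp
  qed simp
  from this[of "list_decode l"] show ?thesis by simp
qed

text \<open>The pair of remaining list and accumulator is iterated \<open>l x\<close> times: a code
  bounds the length of its list, and the step is the identity once the list is empty.\<close>

lemma prim_rec_foldl:
  assumes "prim_rec a" "prim_rec l" "prim_rec (\<lambda>z. h (p1 z) (p1 (p2 z)) (p2 (p2 z)))"
  shows "prim_rec (\<lambda>x. foldl (h x) (a x) (list_decode (l x)))"
proof -
  define g where "g x s = (if p1 s = 0 then s
    else prod_encode (code_tl (p1 s), h x (p2 s) (code_nth (p1 s) 0)))" for x s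
  have g: "prim_rec (\<lambda>z. g (p1 z) (p2 z))"
    unfolding g_def
    by (intro prim_rec_comp3[of h, OF assms(3)] prim_rec_logic prim_rec_code_tl prim_rec_code_nth)
  have g_Cons: "g x (prod_encode (list_encode (y # ys), b)) = prod_encode (list_encode ys, h x b y)"
    for x y ys b
    using code_tl_list_encode[of "y # ys"] code_nth_list_encode[of "y # ys" 0]
    by (simp add: g_def)
  have g_Nil: "(g x ^^ n) (prod_encode (0, b)) = prod_encode (0, b)" for x n b
    by (induction n) (simp_all add: g_def)
  have *: "length ys \<le> n \<Longrightarrow> (g x ^^ n) (prod_encode (list_encode ys, b)) =
      prod_encode (0, foldl (h x) b ys)" for x n b ys
  proof (induction ys arbitrary: n b)
    case (Cons y ys)
    then obtain m where "n = Suc m" "length ys \<le> m"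
      by (metis Suc_le_D Suc_le_mono length_Cons)
    then show ?case
      using Cons.IH[of m] by (simp del: funpow.simps list_encode.simps add: funpow_Suc_right g_Cons)
  qed (simp add: g_Nil)
  have "prim_rec (\<lambda>x. p2 ((g x ^^ l x) (prod_encode (l x, a x))))"
    by (intro prim_rec_funpow prim_rec_basic g assms)
  moreover have "p2 ((g x ^^ l x) (prod_encode (l x, a x))) = foldl (h x) (a x) (list_decode (l x))"
    for x
    using *[of "list_decode (l x)" "l x" x "a x"] by (simp add: length_list_decode_le)
  ultimately show ?thesis by simp
qed

lemma prim_rec_length: 
  assumes "prim_rec f" shows "prim_rec (\<lambda>x. length (list_decode (f x)))"
proof -
  have "foldl (\<lambda>a _. Suc a) n xs = n + length xs" for n and xs :: "nat list"
    by (induction xs arbitrary: n) simp_all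
  moreover have "prim_rec (\<lambda>x. foldl (\<lambda>a _. Suc a) 0 (list_decode (f x)))"
    by (intro prim_rec_foldl prim_rec_basic assms)
  ultimately show ?thesis by simp
qed

lemma prim_rec_rev:
  assumes "prim_rec f" shows "prim_rec (\<lambda>x. list_encode (rev (list_decode (f x))))"
proof -
  have "foldl (\<lambda>a y. code_cons y a) (list_encode ys) xs = list_encode (rev xs @ ys)" for xs ys
    by (induction xs arbitrary: ys) (simp_all del: list_encode.simps)
  from this[of "[]"] have "foldl (\<lambda>a y. code_cons y a) 0 xs = list_encode (rev xs)" for xs
    by simp
  moreover have "prim_rec (\<lambda>x. foldl (\<lambda>a y. code_cons y a) 0 (list_decode (f x)))"
    by (intro prim_rec_foldl prim_rec_code_cons prim_rec_basic assms)
  ultimately show ?thesis by simp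
qed

section \<open>Counter programs\<close>

text \<open>Intermediate language between primitive recursive functions and Turing machines; tapes
  and heads are hidden behind counters.\<close>

datatype com =
    Inc nat
  | Dec nat
  | Seq com com (infixr ";;" 60)
  | While nat com
  | Cond com nat com
  | Read nat
  | Out bool

text \<open>Register contents, number of input entries already read, and output so far.\<close>

type_synonym state = "(nat \<Rightarrow> nat) \<times> nat \<times> bool list"

text \<open>Big-step semantics, hence about terminating commands only; endless machines arise later
  by repeating such a command forever.\<close>

inductive exec_com :: "(nat \<Rightarrow> nat) \<Rightarrow> com \<Rightarrow> state \<Rightarrow> state \<Rightarrow> bool" for p where
  Inc: "exec_com p (Inc i) (r, k, w) (r(i := Suc (r i)), k, w)"
| Dec: "exec_com p (Dec i) (r, k, w) (r(i := r i - 1), k, w)"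
| Seq: "exec_com p c s s' \<Longrightarrow> exec_com p d s' s'' \<Longrightarrow> exec_com p (c ;; d) s s''"
| While_end: "r i = 0 \<Longrightarrow> exec_com p (While i c) (r, k, w) (r, k, w)"
| While_step: "r i \<noteq> 0 \<Longrightarrow> exec_com p c (r, k, w) s' \<Longrightarrow> exec_com p (While i c) s' s'' \<Longrightarrow>
    exec_com p (While i c) (r, k, w) s''"
| Cond_nonzero: "r i \<noteq> 0 \<Longrightarrow> exec_com p c (r, k, w) s' \<Longrightarrow> exec_com p (Cond c i d) (r, k, w) s'"
| Cond_zero: "r i = 0 \<Longrightarrow> exec_com p d (r, k, w) s' \<Longrightarrow> exec_com p (Cond c i d) (r, k, w) s'"
| Read: "exec_com p (Read i) (r, k, w) (r(i := r i + p k), Suc k, w)"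
| Out: "exec_com p (Out b) (r, k, w) (r, k, w @ [b])"

section \<open>Register transfers and Cantor pairing\<close>

definition move :: "nat \<Rightarrow> nat \<Rightarrow> com" where
  "move i j = While i (Dec i ;; Inc j)"

lemma exec_move:
  "i \<noteq> j \<Longrightarrow> exec_com p (move i j) (r, k, w) (r(j := r j + r i, i := 0), k, w)"
proof (induction "r i" arbitrary: r)
  case 0
  then have "r(j := r j + r i, i := 0) = r"
    by auto
  then show ?case
    unfolding move_def using exec_com.While_end[of r i] 0 by metis
next
  case (Suc n)
  define r' where "r' = r(i := r i - 1, j := Suc (r j))"
  have "exec_com p (Dec i ;; Inc j) (r, k, w) (r', k, w)"
    using exec_com.Seq[OF exec_com.Dec[of p i r k w] exec_com.Inc[of p j]] Suc.prems
    by (simp add: r'_def)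
  moreover have "exec_com p (move i j) (r', k, w) (r'(j := r' j + r' i, i := 0), k, w)"
    using Suc by (intro Suc.hyps(1)) (simp_all add: r'_def)
  moreover have "r'(j := r' j + r' i, i := 0) = r(j := r j + r i, i := 0)"
    using Suc by (auto simp: r'_def)
  ultimately show ?case
    unfolding move_def using Suc(2) by (metis exec_com.While_step Zero_not_Suc)
qed

definition move2 :: "nat \<Rightarrow> nat \<Rightarrow> nat \<Rightarrow> com" where
  "move2 i j l = While i (Dec i ;; Inc j ;; Inc l)"

lemma exec_move2:
  assumes "i \<noteq> j" "i \<noteq> l" "j \<noteq> l"
  shows "exec_com p (move2 i j l) (r, k, w) (r(j := r j + r i, l := r l + r i, i := 0), k, w)"
proof (induction "r i" arbitrary: r)
  case 0
  then have "r(j := r j + r i, l := r l + r i, i := 0) = r"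
    by auto
  then show ?case
    unfolding move2_def using exec_com.While_end[of r i] 0 by metis
next
  case (Suc n)
  define r' where "r' = r(i := r i - 1, j := Suc (r j), l := Suc (r l))"
  have "exec_com p (Dec i ;; Inc j ;; Inc l) (r, k, w) (r', k, w)"
    using exec_com.Seq[OF exec_com.Dec[of p i r k w]
        exec_com.Seq[OF exec_com.Inc[of p j] exec_com.Inc[of p l]]] assms
    by (simp add: r'_def)
  moreover have "exec_com p (move2 i j l) (r', k, w)
      (r'(j := r' j + r' i, l := r' l + r' i, i := 0), k, w)"
    using Suc assms by (intro Suc.hyps(1)) (simp_all add: r'_def)
  moreover have "r'(j := r' j + r' i, l := r' l + r' i, i := 0) =
      r(j := r j + r i, l := r l + r i, i := 0)"
    using Suc(2) assms by (auto simp: r'_def)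
  ultimately show ?case
    unfolding move2_def using Suc(2) by (metis exec_com.While_step Zero_not_Suc)
qed

definition copy :: "nat \<Rightarrow> com" where
  "copy b = move2 b (b + 1) (b + 2) ;; move (b + 2) b"

lemma exec_copy:
  assumes "\<forall>j>b. r j = 0"
  shows "exec_com p (copy b) (r, k, w) (r(b + 1 := r b), k, w)"
proof -
  have "exec_com p (move2 b (b + 1) (b + 2)) (r, k, w) (r(b + 1 := r b, b + 2 := r b, b := 0), k, w)"
    using exec_move2[of b "b + 1" "b + 2" p r k w] assms by simp
  moreover have "exec_com p (move (b + 2) b) (r(b + 1 := r b, b + 2 := r b, b := 0), k, w)
    (r(b + 1 := r b), k, w)"
    using exec_move[of "b + 2" b p "r(b + 1 := r b, b + 2 := r b, b := 0)" k w] assms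
    by (simp add: fun_upd_twist fun_upd_idem)
  ultimately show ?thesis
    unfolding copy_def by (rule exec_com.Seq)
qed

definition swap :: "nat \<Rightarrow> com" where
  "swap b = move b (b + 2) ;; move (b + 1) b ;; move (b + 2) (b + 1)"

lemma exec_swap:
  assumes "\<forall>j>b + 1. r j = 0"
  shows "exec_com p (swap b) (r, k, w) (r(b := r (b + 1), b + 1 := r b), k, w)"
proof -
  let ?r1 = "r(b + 2 := r b, b := 0)" and ?r2 = "r(b + 2 := r b, b := r (b + 1), b + 1 := 0)"
  have "exec_com p (move b (b + 2)) (r, k, w) (?r1, k, w)"
    using exec_move[of b "b + 2" p r k w] assms by simp
  moreover have "exec_com p (move (b + 1) b) (?r1, k, w) (?r2, k, w)"
    using exec_move[of "b + 1" b p ?r1 k w] by simp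
  moreover have "?r2(b + 1 := ?r2 (b + 1) + ?r2 (b + 2), b + 2 := 0) =
      r(b := r (b + 1), b + 1 := r b)"
    using assms by auto
  then have "exec_com p (move (b + 2) (b + 1)) (?r2, k, w) (r(b := r (b + 1), b + 1 := r b), k, w)"
    using exec_move[of "b + 2" "b + 1" p ?r2 k w] by simp
  ultimately show ?thesis
    unfolding swap_def by (blast intro: exec_com.Seq)
qed

text \<open>With \<open>n\<close> in register \<open>b\<close>, the summands \<open>n\<close>,
  \<open>n - 1\<close>, ..., \<open>1\<close> are added to register \<open>b + 2\<close>; register
  \<open>b + 1\<close> is scratch space.\<close>

definition add_triangle :: "nat \<Rightarrow> com" where
  "add_triangle b = While b (move2 b (b + 2) (b + 1) ;; Dec (b + 1) ;; move (b + 1) b)"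

lemma exec_add_triangle:
  "r (b + 1) = 0 \<Longrightarrow> exec_com p (add_triangle b) (r, k, w)
     (r(b + 2 := r (b + 2) + triangle (r b), b := 0), k, w)"
proof (induction "r b" arbitrary: r)
  case 0
  then have "r(b + 2 := r (b + 2) + triangle (r b), b := 0) = r"
    by auto
  then show ?case
    unfolding add_triangle_def using exec_com.While_end[of r b] 0 by metis
next
  case (Suc n)
  let ?r1 = "r(b + 2 := r (b + 2) + r b, b + 1 := r b, b := 0)"
  let ?r2 = "r(b + 2 := r (b + 2) + r b, b + 1 := n, b := 0)"
  define r' where "r' = r(b + 2 := r (b + 2) + r b, b := n)"
  have 1: "exec_com p (move2 b (b + 2) (b + 1)) (r, k, w) (?r1, k, w)"
    using exec_move2[of b "b + 2" "b + 1" p r k w] Suc.prems by simp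
  have "?r1(b + 1 := ?r1 (b + 1) - 1) = ?r2"
    using Suc(2) by (auto simp: fun_eq_iff)
  then have 2: "exec_com p (Dec (b + 1)) (?r1, k, w) (?r2, k, w)"
    using exec_com.Dec[of p "b + 1" ?r1 k w] by metis
  have "?r2(b := ?r2 b + ?r2 (b + 1), b + 1 := 0) = r'"
    using Suc.prems by (auto simp: r'_def fun_eq_iff)
  then have 3: "exec_com p (move (b + 1) b) (?r2, k, w) (r', k, w)"
    using exec_move[of "b + 1" b p ?r2 k w] by (metis add.commute n_not_Suc_n plus_1_eq_Suc)
  have "exec_com p (add_triangle b) (r', k, w)
      (r'(b + 2 := r' (b + 2) + triangle (r' b), b := 0), k, w)"
    using Suc.prems by (intro Suc.hyps(1)) (simp_all add: r'_def)
  moreover have "r'(b + 2 := r' (b + 2) + triangle (r' b), b := 0) =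
      r(b + 2 := r (b + 2) + triangle (r b), b := 0)"
    using Suc(2)[symmetric] by (auto simp: r'_def fun_eq_iff)
  ultimately show ?case
    unfolding add_triangle_def using Suc(2) exec_com.Seq[OF 1 exec_com.Seq[OF 2 3]]
    by (metis exec_com.While_step Zero_not_Suc)
qed

text \<open>Uses \<open>prod_encode (x, y) = triangle (x + y) + x\<close>. The first component is
  taken from register \<open>b + 1\<close> and the second from \<open>b\<close>, which is how
  \<open>fork\<close> leaves them.\<close>

definition encode_pair :: "nat \<Rightarrow> com" where
  "encode_pair b = move2 (b + 1) b (b + 2) ;; add_triangle b ;; move (b + 2) b"

lemma exec_encode_pair:
  assumes "\<forall>j>b + 1. r j = 0"
  shows "exec_com p (encode_pair b) (r, k, w)
    (r(b := prod_encode (r (b + 1), r b), b + 1 := 0), k, w)"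
proof -
  let ?r1 = "r(b := r b + r (b + 1), b + 2 := r (b + 1), b + 1 := 0)"
  let ?r2 = "r(b + 2 := r (b + 1) + triangle (r b + r (b + 1)), b + 1 := 0, b := 0)"
  have 1: "exec_com p (move2 (b + 1) b (b + 2)) (r, k, w) (?r1, k, w)"
    using exec_move2[of "b + 1" b "b + 2" p r k w] assms by simp
  have "?r1(b + 2 := ?r1 (b + 2) + triangle (?r1 b), b := 0) = ?r2"
    by (auto simp: fun_eq_iff)
  then have 2: "exec_com p (add_triangle b) (?r1, k, w) (?r2, k, w)"
    using exec_add_triangle[of ?r1 b p k w] by simp
  have "?r2(b := ?r2 b + ?r2 (b + 2), b + 2 := 0) =
      r(b := prod_encode (r (b + 1), r b), b + 1 := 0)"
    using assms by (auto simp: fun_eq_iff prod_encode_def add.commute)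
  then have 3: "exec_com p (move (b + 2) b) (?r2, k, w)
      (r(b := prod_encode (r (b + 1), r b), b + 1 := 0), k, w)"
    using exec_move[of "b + 2" b p ?r2 k w] by simp
  show ?thesis
    unfolding encode_pair_def by (rule exec_com.Seq[OF 1 exec_com.Seq[OF 2 3]])
qed

text \<open>Counts register \<open>b\<close> down while registers \<open>b + 1\<close> and
  \<open>b + 2\<close> walk through the pairs in the order of their codes; the second component
  being \<open>0\<close> signals the end of a diagonal.\<close>

definition decode_pair :: "nat \<Rightarrow> com" where
  "decode_pair b = While b (Dec b ;; Cond (Dec (b + 2) ;; Inc (b + 1)) (b + 2)
     (move (b + 1) (b + 2) ;; Inc (b + 2)))"

lemma prod_decode_Suc:
  "prod_decode (Suc n) = (case prod_decode n of (x, 0) \<Rightarrow> (0, Suc x) | (x, Suc y) \<Rightarrow> (Suc x, y))"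
proof -
  obtain x y where xy: "prod_decode n = (x, y)"
    by force
  then have n: "n = prod_encode (x, y)"
    by (metis prod_decode_inverse)
  have "Suc n = prod_encode (case (x, y) of (x, 0) \<Rightarrow> (0, Suc x) | (x, Suc y) \<Rightarrow> (Suc x, y))"
    by (cases y) (simp_all add: n prod_encode_def)
  then show ?thesis
    by (simp add: xy)
qed

text \<open>The walk may start at any pair, that with code \<open>m\<close>, so that the induction
  on the counter goes through.\<close>

lemma exec_decode_pair:
  "r (b + 1) = p1 m \<Longrightarrow> r (b + 2) = p2 m \<Longrightarrow> exec_com p (decode_pair b) (r, k, w)
     (r(b := 0, b + 1 := p1 (m + r b), b + 2 := p2 (m + r b)), k, w)"
proof (induction "r b" arbitrary: r m)
  case 0
  then have "r(b := 0, b + 1 := p1 (m + r b), b + 2 := p2 (m + r b)) = r"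
    by (auto simp: fun_eq_iff)
  then show ?case
    unfolding decode_pair_def using exec_com.While_end[of r b] 0 by metis
next
  case (Suc n)
  define r1 where "r1 = r(b := n)"
  define r' where "r' = r(b := n, b + 1 := p1 (Suc m), b + 2 := p2 (Suc m))"
  have 1: "exec_com p (Dec b) (r, k, w) (r1, k, w)"
    using exec_com.Dec[of p b r k w] Suc(2)[symmetric] by (simp add: r1_def)
  have 2: "exec_com p (Cond (Dec (b + 2) ;; Inc (b + 1)) (b + 2)
     (move (b + 1) (b + 2) ;; Inc (b + 2))) (r1, k, w) (r', k, w)"
  proof (cases "r (b + 2)")
    case 0
    have "r1(b + 2 := r (b + 1), b + 1 := 0, b + 2 := Suc (r (b + 1))) = r'"
      using 0 Suc.prems
      by (auto simp: r1_def r'_def fun_eq_iff prod_decode_Suc split: prod.splits nat.splits)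
    moreover have "exec_com p (move (b + 1) (b + 2)) (r1, k, w)
        (r1(b + 2 := r (b + 1), b + 1 := 0), k, w)"
      using exec_move[of "b + 1" "b + 2" p r1 k w] 0 by (simp add: r1_def)
    ultimately have "exec_com p (move (b + 1) (b + 2) ;; Inc (b + 2)) (r1, k, w) (r', k, w)"
      using exec_com.Seq exec_com.Inc[of p "b + 2" "r1(b + 2 := r (b + 1), b + 1 := 0)" k w]
      by fastforce
    then show ?thesis
      using 0 by (intro exec_com.Cond_zero) (simp_all add: r1_def)
  next
    case (Suc y)
    have "r1(b + 2 := r1 (b + 2) - 1, b + 1 := Suc (r1 (b + 1))) = r'"
      using Suc Suc.prems
      by (auto simp: r1_def r'_def fun_eq_iff prod_decode_Suc split: prod.splits nat.splits)
    then have "exec_com p (Dec (b + 2) ;; Inc (b + 1)) (r1, k, w) (r', k, w)"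
      using exec_com.Seq[OF exec_com.Dec[of p "b + 2" r1 k w] exec_com.Inc[of p "b + 1"]]
      by simp
    then show ?thesis
      using Suc by (intro exec_com.Cond_nonzero) (simp_all add: r1_def)
  qed
  have "exec_com p (decode_pair b) (r', k, w)
     (r'(b := 0, b + 1 := p1 (Suc m + r' b), b + 2 := p2 (Suc m + r' b)), k, w)"
    by (rule Suc.hyps(1)) (simp_all add: r'_def)
  moreover have "r'(b := 0, b + 1 := p1 (Suc m + r' b), b + 2 := p2 (Suc m + r' b)) =
    r(b := 0, b + 1 := p1 (m + r b), b + 2 := p2 (m + r b))"
    using Suc(2)[symmetric] by (auto simp: r'_def fun_eq_iff)
  ultimately show ?case
    unfolding decode_pair_def using Suc(2) exec_com.Seq[OF 1 2]
    by (metis exec_com.While_step Zero_not_Suc)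
qed

text \<open>Registers above \<open>b\<close> serve as a stack: they are \<open>0\<close> before and after the computation.\<close>

definition computes :: "com \<Rightarrow> nat \<Rightarrow> (nat \<Rightarrow> nat) \<Rightarrow> bool" where
  "computes c b f \<longleftrightarrow> (\<forall>r p k w. (\<forall>j>b. r j = 0) \<longrightarrow>
     exec_com p c (r, k, w) (r(b := f (r b)), k, w))"

definition clear :: "nat \<Rightarrow> com" where
  "clear i = While i (Dec i)"

lemma exec_clear: "exec_com p (clear i) (r, k, w) (r(i := 0), k, w)"
proof (induction "r i" arbitrary: r)
  case 0
  then show ?case
    unfolding clear_def using exec_com.While_end[of r i] by (metis fun_upd_triv)
next
  case (Suc n)
  have "exec_com p (clear i) (r(i := r i - 1), k, w) (r(i := r i - 1, i := 0), k, w)"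
    using Suc(2)[symmetric] by (intro Suc.hyps(1)) simp
  then show ?case
    unfolding clear_def using Suc(2)
    by (metis exec_com.While_step Zero_not_Suc exec_com.Dec fun_upd_upd)
qed

section \<open>Counter programs for primitive recursive functions\<close>

lemma computes_zero: "computes (clear b) b (\<lambda>_. 0)"
  by (simp add: computes_def exec_clear)

lemma computes_Suc: "computes (Inc b) b Suc"
  by (simp add: computes_def exec_com.Inc)

lemma computes_comp:
  assumes "computes c b f" "computes d b g"
  shows "computes (d ;; c) b (\<lambda>x. f (g x))"
  unfolding computes_def
proof (intro allI impI)
  fix r :: "nat \<Rightarrow> nat" and p k w
  assume r: "\<forall>j>b. r j = 0"
  then have "exec_com p d (r, k, w) (r(b := g (r b)), k, w)"
    using assms(2) by (simp add: computes_def)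
  moreover have "exec_com p c (r(b := g (r b)), k, w) (r(b := f (g (r b))), k, w)"
    using assms(1)[unfolded computes_def, rule_format, of "r(b := g (r b))" p k w] r by simp
  ultimately show "exec_com p (d ;; c) (r, k, w) (r(b := f (g (r b))), k, w)"
    by (rule exec_com.Seq)
qed

lemma exec_decode_pair_0:
  assumes "\<forall>j>b. r j = 0"
  shows "exec_com p (decode_pair b) (r, k, w)
    (r(b := 0, b + 1 := p1 (r b), b + 2 := p2 (r b)), k, w)"
  using exec_decode_pair[of r b 0 p k w] assms by simp

lemma computes_fst: "computes (decode_pair b ;; clear (b + 2) ;; move (b + 1) b) b p1"
  unfolding computes_def
proof (intro allI impI)
  fix r :: "nat \<Rightarrow> nat" and p k w
  assume r: "\<forall>j>b. r j = 0"
  let ?r = "r(b := 0, b + 1 := p1 (r b), b + 2 := p2 (r b))"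
  have "(?r(b + 2 := 0))(b := (?r(b + 2 := 0)) b + (?r(b + 2 := 0)) (b + 1), b + 1 := 0) =
      r(b := p1 (r b))"
    using r by (auto simp: fun_eq_iff)
  then have "exec_com p (move (b + 1) b) (?r(b + 2 := 0), k, w) (r(b := p1 (r b)), k, w)"
    using exec_move[of "b + 1" b p "?r(b + 2 := 0)" k w] by simp
  then show "exec_com p (decode_pair b ;; clear (b + 2) ;; move (b + 1) b) (r, k, w)
      (r(b := p1 (r b)), k, w)"
    using exec_decode_pair_0[OF r] exec_clear by (meson exec_com.Seq)
qed

lemma computes_snd: "computes (decode_pair b ;; clear (b + 1) ;; move (b + 2) b) b p2"
  unfolding computes_def
proof (intro allI impI)
  fix r :: "nat \<Rightarrow> nat" and p k w
  assume r: "\<forall>j>b. r j = 0"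
  let ?r = "r(b := 0, b + 1 := p1 (r b), b + 2 := p2 (r b))"
  have "(?r(b + 1 := 0))(b := (?r(b + 1 := 0)) b + (?r(b + 1 := 0)) (b + 2), b + 2 := 0) =
      r(b := p2 (r b))"
    using r by (auto simp: fun_eq_iff)
  then have "exec_com p (move (b + 2) b) (?r(b + 1 := 0), k, w) (r(b := p2 (r b)), k, w)"
    using exec_move[of "b + 2" b p "?r(b + 1 := 0)" k w] by simp
  then show "exec_com p (decode_pair b ;; clear (b + 1) ;; move (b + 2) b) (r, k, w)
      (r(b := p2 (r b)), k, w)"
    using exec_decode_pair_0[OF r] exec_clear by (meson exec_com.Seq)
qed

text \<open>The second component is computed first, on a copy in register \<open>b + 1\<close>. The
  swap brings the argument back to the top of the stack, where the first component replaces
  it.\<close>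

definition fork :: "nat \<Rightarrow> com \<Rightarrow> com \<Rightarrow> com" where
  "fork b c d = copy b ;; d ;; swap b ;; c"

lemma exec_fork:
  assumes "computes c (b + 1) f" "computes d (b + 1) g" "\<forall>j>b. r j = 0"
  shows "exec_com p (fork b c d) (r, k, w) (r(b := g (r b), b + 1 := f (r b)), k, w)"
proof -
  have 1: "exec_com p (copy b) (r, k, w) (r(b + 1 := r b), k, w)"
    by (rule exec_copy[OF assms(3)])
  have 2: "exec_com p d (r(b + 1 := r b), k, w) (r(b + 1 := g (r b)), k, w)"
    using assms(2)[unfolded computes_def, rule_format, of "r(b + 1 := r b)" p k w] assms(3) by simp
  have 3: "exec_com p (swap b) (r(b + 1 := g (r b)), k, w) (r(b := g (r b), b + 1 := r b), k, w)"
    using exec_swap[of b "r(b + 1 := g (r b))" p k w] assms(3) by (simp add: fun_upd_twist)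
  have 4: "exec_com p c (r(b := g (r b), b + 1 := r b), k, w)
      (r(b := g (r b), b + 1 := f (r b)), k, w)"
    using assms(1)[unfolded computes_def, rule_format, of "r(b := g (r b), b + 1 := r b)" p k w]
      assms(3) by simp
  show ?thesis
    unfolding fork_def by (rule exec_com.Seq[OF 1 exec_com.Seq[OF 2 exec_com.Seq[OF 3 4]]])
qed

lemma computes_pair:
  assumes "computes c (b + 1) f" "computes d (b + 1) g"
  shows "computes (fork b c d ;; encode_pair b) b (\<lambda>x. prod_encode (f x, g x))"
  unfolding computes_def
proof (intro allI impI)
  fix r :: "nat \<Rightarrow> nat" and p k w
  assume r: "\<forall>j>b. r j = 0"
  let ?r = "r(b := g (r b), b + 1 := f (r b))"
  have "?r(b := prod_encode (?r (b + 1), ?r b), b + 1 := 0) =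
      r(b := prod_encode (f (r b), g (r b)))"
    using r by (auto simp: fun_eq_iff)
  then have "exec_com p (encode_pair b) (?r, k, w) (r(b := prod_encode (f (r b), g (r b))), k, w)"
    using exec_encode_pair[of b ?r p k w] r by simp
  then show "exec_com p (fork b c d ;; encode_pair b) (r, k, w)
      (r(b := prod_encode (f (r b), g (r b))), k, w)"
    using exec_fork[OF assms r] by (meson exec_com.Seq)
qed

lemma exec_while_funpow:
  assumes "computes c (b + 1) f"
  shows "(\<forall>j>b + 1. r j = 0) \<Longrightarrow> exec_com p (While b (Dec b ;; c)) (r, k, w)
    (r(b := 0, b + 1 := (f ^^ r b) (r (b + 1))), k, w)"
proof (induction "r b" arbitrary: r)
  case 0
  then have "r(b := 0, b + 1 := (f ^^ r b) (r (b + 1))) = r"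
    by (auto simp: fun_eq_iff)
  then show ?case
    using exec_com.While_end[of r b] 0 by metis
next
  case (Suc n)
  define r' where "r' = r(b := n, b + 1 := f (r (b + 1)))"
  have "exec_com p (Dec b) (r, k, w) (r(b := n), k, w)"
    using exec_com.Dec[of p b r k w] Suc(2)[symmetric] by simp
  moreover have "exec_com p c (r(b := n), k, w) (r', k, w)"
    using assms[unfolded computes_def, rule_format, of "r(b := n)" p k w] Suc.prems
    by (simp add: r'_def)
  moreover have "exec_com p (While b (Dec b ;; c)) (r', k, w)
    (r'(b := 0, b + 1 := (f ^^ r' b) (r' (b + 1))), k, w)"
    using Suc.prems by (intro Suc.hyps(1)) (simp_all add: r'_def)
  moreover have "r'(b := 0, b + 1 := (f ^^ r' b) (r' (b + 1))) =
      r(b := 0, b + 1 := (f ^^ r b) (r (b + 1)))"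
    using Suc(2)[symmetric] by (auto simp: r'_def fun_eq_iff funpow_swap1)
  ultimately show ?case
    using Suc(2) by (metis exec_com.Seq exec_com.While_step Zero_not_Suc)
qed

text \<open>\<open>fork\<close> leaves the number of iterations in register \<open>b\<close> and the
  start value in \<open>b + 1\<close>, where the loop body operates.\<close>

lemma computes_iter:
  assumes "computes c1 (b + 1) p1" "computes c2 (b + 1) p2" "computes c (b + 1) f"
  shows "computes (fork b c1 c2 ;; While b (Dec b ;; c) ;; move (b + 1) b) b
    (\<lambda>x. (f ^^ p2 x) (p1 x))"
  unfolding computes_def
proof (intro allI impI)
  fix r :: "nat \<Rightarrow> nat" and p k w
  assume r: "\<forall>j>b. r j = 0"
  let ?y = "(f ^^ p2 (r b)) (p1 (r b))"
  have 1: "exec_com p (While b (Dec b ;; c)) (r(b := p2 (r b), b + 1 := p1 (r b)), k, w)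
      (r(b := 0, b + 1 := ?y), k, w)"
    using exec_while_funpow[OF assms(3), of "r(b := p2 (r b), b + 1 := p1 (r b))" p k w] r
    by (simp add: fun_upd_twist)
  have "(r(b := 0, b + 1 := ?y))(b := (r(b := 0, b + 1 := ?y)) b + (r(b := 0, b + 1 := ?y)) (b + 1),
      b + 1 := 0) = r(b := ?y)"
    using r by (auto simp: fun_eq_iff)
  then have "exec_com p (move (b + 1) b) (r(b := 0, b + 1 := ?y), k, w) (r(b := ?y), k, w)"
    using exec_move[of "b + 1" b p "r(b := 0, b + 1 := ?y)" k w] by simp
  then show "exec_com p (fork b c1 c2 ;; While b (Dec b ;; c) ;; move (b + 1) b) (r, k, w)
      (r(b := ?y), k, w)"
    using exec_fork[OF assms(1,2) r] 1 by (meson exec_com.Seq)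
qed

text \<open>The base register is arbitrary in the induction, because pairing and iteration evaluate
  their parts one register higher.\<close>

lemma prim_rec_computes: "prim_rec f \<Longrightarrow> \<exists>c. computes c b f"
proof (induction arbitrary: b rule: prim_rec.induct)
  case (iter f)
  then show ?case
    using computes_fst computes_snd computes_iter by meson
qed (use computes_zero computes_Suc computes_fst computes_snd computes_comp computes_pair in meson)+

section \<open>Compilation to Turing machines\<close>

definition reaches :: "instr list \<Rightarrow> (nat \<Rightarrow> bool) \<Rightarrow> config \<Rightarrow> config \<Rightarrow> bool" where
  "reaches P x c c' \<longleftrightarrow> (\<exists>t. c' = (step P x ^^ t) c)"

lemma reaches_refl: "reaches P x c c"
  unfolding reaches_def by (rule exI[of _ 0]) simp

lemma reaches_trans: "reaches P x c c' \<Longrightarrow> reaches P x c' c'' \<Longrightarrow> reaches P x c c''"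
  unfolding reaches_def by (metis comp_apply funpow_add)

lemma reaches_exec:
  assumes "pc c < length P" "P ! pc c = I" "reaches P x (exec x I c) c'"
  shows "reaches P x c c'"
proof -
  have "reaches P x c (step P x c)"
    unfolding reaches_def by (rule exI[of _ 1]) simp
  moreover have "step P x c = exec x I c"
    using assms by (simp add: step_def halted_def)
  ultimately show ?thesis
    using assms(3) reaches_trans by metis
qed

text \<open>Jump targets are absolute, so compiled code is meaningful only at its own address inside
  the whole program.\<close>

primrec embedded :: "instr list \<Rightarrow> nat \<Rightarrow> instr list \<Rightarrow> bool" where
  "embedded P a [] \<longleftrightarrow> True"
| "embedded P a (I # C) \<longleftrightarrow> a < length P \<and> P ! a = I \<and> embedded P (Suc a) C"

lemma embedded_append:
  "embedded P a (C @ D) \<longleftrightarrow> embedded P a C \<and> embedded P (a + length C) D"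
  by (induction C arbitrary: a) simp_all

lemma embedded_infix: "embedded (A @ C @ B) (length A) C"
proof (induction C arbitrary: A)
  case (Cons I C)
  from Cons[of "A @ [I]"] show ?case by simp
qed simp

text \<open>Tape \<open>i < N\<close> is a counter: its head position is the value, and cell \<open>0\<close> carries a mark
  so that the value can be tested for \<open>0\<close>.  Tape \<open>N\<close> stays blank, so that testing it for a
  blank is an unconditional jump.\<close>

fun compile :: "nat \<Rightarrow> nat \<Rightarrow> com \<Rightarrow> instr list" where
  "compile N a (Inc i) = [Right i]"
| "compile N a (Dec i) = [If_Work i 1 (a + 2), Left i]"
| "compile N a (c ;; d) = (let C = compile N a c in C @ compile N (a + length C) d)"
| "compile N a (While i c) = (let C = compile N (Suc a) c in
     If_Work i 1 (a + length C + 2) # C @ [If_Work N 0 a])"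
| "compile N a (Cond c i d) = (let C = compile N (Suc a) c; D = compile N (a + length C + 2) d in
     If_Work i 1 (a + length C + 2) # C @ If_Work N 0 (a + length C + length D + 2) # D)"
| "compile N a (Read i) = [If_Input (a + 2), If_Work N 0 (a + 5), Input_Right, Right i,
     If_Work N 0 a, Input_Right]"
| "compile N a (Out b) = [Output b]"

fun registers_below :: "nat \<Rightarrow> com \<Rightarrow> bool" where
  "registers_below N (Inc i) \<longleftrightarrow> i < N"
| "registers_below N (Dec i) \<longleftrightarrow> i < N"
| "registers_below N (c ;; d) \<longleftrightarrow> registers_below N c \<and> registers_below N d"
| "registers_below N (While i c) \<longleftrightarrow> i < N \<and> registers_below N c"
| "registers_below N (Cond c i d) \<longleftrightarrow> i < N \<and> registers_below N c \<and> registers_below N d"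
| "registers_below N (Read i) \<longleftrightarrow> i < N"
| "registers_below N (Out b) \<longleftrightarrow> True"

lemma registers_below_mono: "registers_below N c \<Longrightarrow> N \<le> M \<Longrightarrow> registers_below M c"
  by (induction c) auto

lemma registers_below_ex: "\<exists>N. registers_below N c"
proof (induction c)
  case (Seq c d)
  then obtain N M where "registers_below N c" "registers_below M d" by blast
  then have "registers_below (max N M) (c ;; d)"
    by (auto intro: registers_below_mono)
  then show ?case ..
next
  case (While i c)
  then obtain N where "registers_below N c" by blast
  then have "registers_below (max N (Suc i)) (While i c)"
    by (auto intro: registers_below_mono)
  then show ?case ..
next
  case (Cond c i d)
  then obtain N M where "registers_below N c" "registers_below M d" by blast
  then have "registers_below (max (max N M) (Suc i)) (Cond c i d)"
    by (auto intro: registers_below_mono)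
  then show ?case ..
qed (auto intro: lessI)

section \<open>Counters on tapes and correctness of the compiled code\<close>

definition mark :: "int \<Rightarrow> nat" where
  "mark z = (if z = 0 then 1 else 0)"

text \<open>The program counter is left open. After \<open>k\<close> entries have been read, the
  input head is on the first cell of the unary block with index \<open>k\<close>.\<close>

definition repr :: "(nat \<Rightarrow> nat) \<Rightarrow> nat \<Rightarrow> state \<Rightarrow> config \<Rightarrow> bool" where
  "repr p N s c \<longleftrightarrow> (\<forall>j<N. head c j = int (fst s j) \<and> work c j = mark) \<and> work c N = (\<lambda>_. 0) \<and>
     in_pos c = (\<Sum>j<fst (snd s). Suc (p j)) \<and> out c = snd (snd s)"

text \<open>The partial sums of block lengths increase strictly, so the only separator that can lie
  in block \<open>k\<close> is its last cell.\<close>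

lemma input_tape_iff:
  assumes "m \<le> p k" shows "input_tape p ((\<Sum>j<k. Suc (p j)) + m) \<longleftrightarrow> m < p k"
proof -
  define S where "S n = (\<Sum>j<n. Suc (p j))" for n
  have S: "strict_mono S"
    by (simp add: S_def strict_mono_Suc_iff)
  have "(\<exists>l. Suc (S k + m) = S (Suc l)) \<longleftrightarrow> m = p k"
  proof
    assume "\<exists>l. Suc (S k + m) = S (Suc l)"
    then obtain l where l: "Suc (S k + m) = S (Suc l)" by blast
    have Suc_S: "S (Suc k) = Suc (S k + p k)"
      by (simp add: S_def)
    have "S k < S (Suc l)" "S (Suc l) \<le> S (Suc k)"
      using l assms Suc_S by linarith+
    then have "k < Suc l" "Suc l \<le> Suc k"
      using strict_mono_less[OF S] strict_mono_less_eq[OF S] by blast+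
    then have "l = k" by simp
    then show "m = p k" using l Suc_S by simp
  next
    assume "m = p k"
    then show "\<exists>l. Suc (S k + m) = S (Suc l)"
      by (intro exI[of _ k]) (simp add: S_def)
  qed
  then show ?thesis
    using assms by (auto simp: input_tape_def S_def simp flip: lessThan_Suc_atMost)
qed

text \<open>Allows \<open>m\<close> ones of the block to have been passed already, which permits
  induction on the ones that remain.\<close>

lemma reaches_read:
  assumes "embedded P a (compile N a (Read i))" "i < N" "m \<le> p k"
    "pc c = a" "work c N = (\<lambda>_. 0)" "in_pos c = (\<Sum>j<k. Suc (p j)) + m"
  shows "reaches P (input_tape p) c (c\<lparr>pc := a + 6, in_pos := (\<Sum>j<Suc k. Suc (p j)),
    head := (head c)(i := head c i + int (p k - m))\<rparr>)"
  using assms(3-)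
proof (induction "p k - m" arbitrary: m c)
  case 0
  then have "\<not> input_tape p (in_pos c)" "m = p k"
    using input_tape_iff[of m p k] by simp_all
  then have "exec (input_tape p) (If_Input (a + 2)) c = c\<lparr>pc := a + 1\<rparr>"
    "exec (input_tape p) (If_Work N 0 (a + 5)) (c\<lparr>pc := a + 1\<rparr>) = c\<lparr>pc := a + 5\<rparr>"
    "exec (input_tape p) Input_Right (c\<lparr>pc := a + 5\<rparr>) =
      c\<lparr>pc := a + 6, in_pos := (\<Sum>j<Suc k. Suc (p j)),
        head := (head c)(i := head c i + int (p k - m))\<rparr>"
    using 0 by simp_all
  moreover have "a + 5 < length P" "P ! a = If_Input (a + 2)" "P ! (a + 1) = If_Work N 0 (a + 5)"
    "P ! (a + 5) = Input_Right"
    using assms(1) by (simp_all add: numeral_eq_Suc)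
  ultimately show ?case
    using reaches_exec[of c P "If_Input (a + 2)" "input_tape p"]
      reaches_exec[of "c\<lparr>pc := a + 1\<rparr>" P "If_Work N 0 (a + 5)" "input_tape p"]
      reaches_exec[of "c\<lparr>pc := a + 5\<rparr>" P Input_Right "input_tape p", OF _ _ reaches_refl] 0
    by (simp add: add.commute del: exec.simps)
next
  case (Suc n)
  let ?c = "c\<lparr>in_pos := Suc (in_pos c), head := (head c)(i := head c i + 1)\<rparr>"
  have x: "input_tape p (in_pos c)" and m: "m < p k"
    using input_tape_iff[of m p k] Suc by simp_all
  have "reaches P (input_tape p) ?c (?c\<lparr>pc := a + 6, in_pos := (\<Sum>j<Suc k. Suc (p j)),
    head := (head ?c)(i := head ?c i + int (p k - Suc m))\<rparr>)"
    using Suc m by (intro Suc.hyps(1)) simp_all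
  moreover have "head ?c i + int (p k - Suc m) = head c i + int (p k - m)"
    using m by simp
  ultimately have 1: "reaches P (input_tape p) ?c (c\<lparr>pc := a + 6, in_pos := (\<Sum>j<Suc k. Suc (p j)),
    head := (head c)(i := head c i + int (p k - m))\<rparr>)"
    by simp
  let ?c2 = "c\<lparr>pc := a + 2\<rparr>" and ?c3 = "c\<lparr>pc := a + 3, in_pos := Suc (in_pos c)\<rparr>"
  let ?c4 = "?c\<lparr>pc := a + 4\<rparr>"
  have "exec (input_tape p) (If_Input (a + 2)) c = ?c2" "exec (input_tape p) Input_Right ?c2 = ?c3"
    "exec (input_tape p) (Right i) ?c3 = ?c4" "exec (input_tape p) (If_Work N 0 a) ?c4 = ?c"
    using Suc.prems x by (simp_all add: numeral_eq_Suc)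
  moreover have "a + 4 < length P" "P ! a = If_Input (a + 2)" "P ! (a + 2) = Input_Right"
    "P ! (a + 3) = Right i" "P ! (a + 4) = If_Work N 0 a"
    using assms(1) by (simp_all add: numeral_eq_Suc)
  ultimately have "reaches P (input_tape p) c ?c"
    using reaches_exec[of c P "If_Input (a + 2)" "input_tape p" ?c]
      reaches_exec[of ?c2 P Input_Right "input_tape p" ?c]
      reaches_exec[of ?c3 P "Right i" "input_tape p" ?c]
      reaches_exec[of ?c4 P "If_Work N 0 a" "input_tape p" ?c] reaches_refl[of P "input_tape p" ?c]
      Suc.prems
    by (simp del: exec.simps)
  then show ?case
    using 1 by (rule reaches_trans)
qed

text \<open>In the induction on the derivation of \<open>exec_com\<close>, the rest of a loop is a
  derivation of its own, for the same code at the same address.\<close>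

lemma compile_correct:
  assumes "exec_com p c s s'" "registers_below N c" "embedded P a (compile N a c)"
    "repr p N s cfg" "pc cfg = a"
  shows "\<exists>cfg'. reaches P (input_tape p) cfg cfg' \<and> repr p N s' cfg' \<and>
    pc cfg' = a + length (compile N a c)"
  using assms
proof (induction arbitrary: a cfg rule: exec_com.induct)
  case (Inc i r k w)
  have "reaches P (input_tape p) cfg (exec (input_tape p) (Right i) cfg)"
    using Inc by (intro reaches_exec[of cfg, OF _ _ reaches_refl]) auto
  moreover have "repr p N (r(i := Suc (r i)), k, w) (exec (input_tape p) (Right i) cfg)"
    using Inc by (auto simp: repr_def)
  ultimately show ?case
    using Inc by (intro exI conjI) (assumption | simp)+
next
  case (Dec i r k w)
  show ?case
  proof (cases "r i = 0")
    case True
    \<comment> \<open>At value \<open>0\<close> the head is on the mark, and the jump skips the move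
      to the left, in accordance with \<open>0 - 1 = 0\<close>.\<close>
    let ?c = "exec (input_tape p) (If_Work i 1 (a + 2)) cfg"
    have "reaches P (input_tape p) cfg ?c"
      using Dec by (intro reaches_exec[of cfg, OF _ _ reaches_refl]) auto
    moreover have "repr p N (r(i := r i - 1), k, w) ?c" "pc ?c = a + 2"
      using Dec True by (auto simp: repr_def mark_def)
    ultimately show ?thesis
      by (intro exI[of _ ?c]) simp
  next
    case False
    let ?c = "exec (input_tape p) (Left i) (cfg\<lparr>pc := Suc a\<rparr>)"
    have "exec (input_tape p) (If_Work i 1 (a + 2)) cfg = cfg\<lparr>pc := Suc a\<rparr>"
      using Dec False by (auto simp: repr_def mark_def)
    moreover have "reaches P (input_tape p) (cfg\<lparr>pc := Suc a\<rparr>) ?c"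
      using Dec by (intro reaches_exec[of "cfg\<lparr>pc := Suc a\<rparr>", OF _ _ reaches_refl]) auto
    ultimately have "reaches P (input_tape p) cfg ?c"
      using Dec by (intro reaches_exec[of cfg]) auto
    moreover have "repr p N (r(i := r i - 1), k, w) ?c" "pc ?c = a + 2"
      using Dec False by (auto simp: repr_def mark_def)
    ultimately show ?thesis
      by (intro exI[of _ ?c]) simp
  qed
next
  case (Seq c s s' d s'')
  let ?n = "length (compile N a c)"
  have emb: "embedded P a (compile N a c)" "embedded P (a + ?n) (compile N (a + ?n) d)"
    using Seq.prems by (simp_all add: Let_def embedded_append)
  obtain c1 where c1: "reaches P (input_tape p) cfg c1" "repr p N s' c1" "pc c1 = a + ?n"
    using Seq.IH(1)[OF _ emb(1)] Seq.prems by auto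
  obtain c2 where c2: "reaches P (input_tape p) c1 c2" "repr p N s'' c2"
    "pc c2 = a + ?n + length (compile N (a + ?n) d)"
    using Seq.IH(2)[OF _ emb(2) c1(2,3)] Seq.prems by auto
  have "reaches P (input_tape p) cfg c2"
    using c1(1) c2(1) by (rule reaches_trans)
  with c2 show ?case
    by (auto simp: Let_def)
next
  case (While_end r i c k w)
  let ?n = "length (compile N (Suc a) c)"
  let ?c = "cfg\<lparr>pc := a + ?n + 2\<rparr>"
  have "exec (input_tape p) (If_Work i 1 (a + ?n + 2)) cfg = ?c"
    using While_end by (auto simp: repr_def mark_def)
  then have "reaches P (input_tape p) cfg ?c"
    using While_end by (intro reaches_exec[of cfg]) (auto simp: Let_def reaches_refl)
  moreover have "repr p N (r, k, w) ?c"
    using While_end by (auto simp: repr_def)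
  ultimately show ?case
    by (intro exI[of _ ?c]) (simp add: Let_def)
next
  case (While_step r i c k w s' s'')
  let ?n = "length (compile N (Suc a) c)"
  have emb: "embedded P (Suc a) (compile N (Suc a) c)"
    and jmp: "Suc (a + ?n) < length P" "P ! Suc (a + ?n) = If_Work N 0 a"
    and start: "a < length P" "P ! a = If_Work i 1 (a + ?n + 2)"
    using While_step.prems by (simp_all add: Let_def embedded_append)
  have "exec (input_tape p) (If_Work i 1 (a + ?n + 2)) cfg = cfg\<lparr>pc := Suc a\<rparr>"
    using While_step by (auto simp: repr_def mark_def)
  then have 0: "reaches P (input_tape p) cfg (cfg\<lparr>pc := Suc a\<rparr>)"
    using While_step.prems start by (intro reaches_exec[of cfg]) (auto simp: reaches_refl)
  have "repr p N (r, k, w) (cfg\<lparr>pc := Suc a\<rparr>)"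
    using While_step.prems by (auto simp: repr_def)
  then obtain c1 where c1: "reaches P (input_tape p) (cfg\<lparr>pc := Suc a\<rparr>) c1" "repr p N s' c1"
    "pc c1 = Suc a + ?n"
    using While_step.IH(1)[OF _ emb, of "cfg\<lparr>pc := Suc a\<rparr>"] While_step.prems by auto
  have "exec (input_tape p) (If_Work N 0 a) c1 = c1\<lparr>pc := a\<rparr>"
    using c1 by (auto simp: repr_def)
  then have 1: "reaches P (input_tape p) c1 (c1\<lparr>pc := a\<rparr>)"
    using c1 jmp by (intro reaches_exec[of c1]) (auto simp: reaches_refl)
  have "repr p N s' (c1\<lparr>pc := a\<rparr>)"
    using c1 by (auto simp: repr_def)
  then obtain c2 where c2: "reaches P (input_tape p) (c1\<lparr>pc := a\<rparr>) c2" "repr p N s'' c2"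
    "pc c2 = a + length (compile N a (While i c))"
    using While_step.IH(2)[of a "c1\<lparr>pc := a\<rparr>"] While_step.prems by auto
  then show ?case
    using 0 1 c1(1) c2(1) by (blast intro: reaches_trans)
next
  case (Cond_nonzero r i c k w s' d)
  let ?n = "length (compile N (Suc a) c)"
  let ?e = "a + ?n + length (compile N (a + ?n + 2) d) + 2"
  have emb: "embedded P (Suc a) (compile N (Suc a) c)"
    and jmp: "Suc (a + ?n) < length P" "P ! Suc (a + ?n) = If_Work N 0 ?e"
    and start: "a < length P" "P ! a = If_Work i 1 (a + ?n + 2)"
    using Cond_nonzero.prems by (simp_all add: Let_def embedded_append)
  have "exec (input_tape p) (If_Work i 1 (a + ?n + 2)) cfg = cfg\<lparr>pc := Suc a\<rparr>"
    using Cond_nonzero by (auto simp: repr_def mark_def)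
  then have 0: "reaches P (input_tape p) cfg (cfg\<lparr>pc := Suc a\<rparr>)"
    using Cond_nonzero.prems start by (intro reaches_exec[of cfg]) (auto simp: reaches_refl)
  have "repr p N (r, k, w) (cfg\<lparr>pc := Suc a\<rparr>)"
    using Cond_nonzero.prems by (auto simp: repr_def)
  then obtain c1 where c1: "reaches P (input_tape p) (cfg\<lparr>pc := Suc a\<rparr>) c1" "repr p N s' c1"
    "pc c1 = Suc a + ?n"
    using Cond_nonzero.IH[OF _ emb, of "cfg\<lparr>pc := Suc a\<rparr>"] Cond_nonzero.prems by auto
  have "exec (input_tape p) (If_Work N 0 ?e) c1 = c1\<lparr>pc := ?e\<rparr>"
    using c1 by (auto simp: repr_def)
  then have 1: "reaches P (input_tape p) c1 (c1\<lparr>pc := ?e\<rparr>)"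
    using c1 jmp by (intro reaches_exec[of c1]) (auto simp: reaches_refl)
  have "repr p N s' (c1\<lparr>pc := ?e\<rparr>)"
    using c1 by (auto simp: repr_def)
  moreover have "reaches P (input_tape p) cfg (c1\<lparr>pc := ?e\<rparr>)"
    using 0 1 c1(1) by (blast intro: reaches_trans)
  ultimately show ?case
    by (intro exI[of _ "c1\<lparr>pc := ?e\<rparr>"]) (simp add: Let_def)
next
  case (Cond_zero r i d k w s' c)
  let ?n = "length (compile N (Suc a) c)"
  let ?c = "cfg\<lparr>pc := a + ?n + 2\<rparr>"
  have emb: "embedded P (a + ?n + 2) (compile N (a + ?n + 2) d)"
    and start: "a < length P" "P ! a = If_Work i 1 (a + ?n + 2)"
    using Cond_zero.prems by (simp_all add: Let_def embedded_append)
  have "exec (input_tape p) (If_Work i 1 (a + ?n + 2)) cfg = ?c"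
    using Cond_zero by (auto simp: repr_def mark_def)
  then have 0: "reaches P (input_tape p) cfg ?c"
    using Cond_zero.prems start by (intro reaches_exec[of cfg]) (auto simp: reaches_refl)
  have "repr p N (r, k, w) ?c"
    using Cond_zero.prems by (auto simp: repr_def)
  then obtain c1 where c1: "reaches P (input_tape p) ?c c1" "repr p N s' c1"
    "pc c1 = a + ?n + 2 + length (compile N (a + ?n + 2) d)"
    using Cond_zero.IH[OF _ emb, of ?c] Cond_zero.prems by auto
  moreover have "reaches P (input_tape p) cfg c1"
    using 0 c1(1) by (rule reaches_trans)
  ultimately show ?case
    by (intro exI[of _ c1]) (simp add: Let_def)
next
  case (Read i r k w)
  let ?c = "cfg\<lparr>pc := a + 6, in_pos := (\<Sum>j<Suc k. Suc (p j)),
    head := (head cfg)(i := head cfg i + int (p k - 0))\<rparr>"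
  have "reaches P (input_tape p) cfg ?c"
    using Read by (intro reaches_read[where N = N]) (auto simp: repr_def)
  moreover have "repr p N (r(i := r i + p k), Suc k, w) ?c"
    using Read by (auto simp: repr_def)
  ultimately show ?case
    by (intro exI[of _ ?c]) simp
next
  case (Out b r k w)
  let ?c = "exec (input_tape p) (Output b) cfg"
  have "reaches P (input_tape p) cfg ?c"
    using Out by (intro reaches_exec[of cfg, OF _ _ reaches_refl]) auto
  moreover have "repr p N (r, k, w @ [b]) ?c"
    using Out by (auto simp: repr_def)
  ultimately show ?case
    using Out by (intro exI[of _ ?c]) simp
qed

text \<open>Prologue that turns blank tapes into counters with value \<open>0\<close>. It has
  \<open>N\<close> instructions, so compiled code begins at address \<open>N\<close>.\<close>

definition set_marks :: "nat \<Rightarrow> instr list" where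
  "set_marks N = map (\<lambda>i. Write i 1) [0..<N]"

lemma length_set_marks [simp]: "length (set_marks N) = N"
  by (simp add: set_marks_def)

lemma reaches_set_marks:
  assumes "embedded P 0 (set_marks N)"
  shows "\<exists>c. reaches P x init c \<and> repr p N (\<lambda>_. 0, 0, []) c \<and> pc c = N"
proof -
  define c where "c n = init\<lparr>pc := n, work := (\<lambda>j. if j < n then mark else (\<lambda>_. 0))\<rparr>" for n
  have emb: "i < length C \<Longrightarrow> embedded P a C \<Longrightarrow> a + i < length P \<and> P ! (a + i) = C ! i" for i a C
  proof (induction C arbitrary: a i)
    case (Cons I C)
    then show ?case
      using Cons.IH[of "i - 1" "Suc a"] by (cases i) simp_all
  qed simp
  have "n \<le> N \<Longrightarrow> reaches P x init (c n)" for n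
  proof (induction n)
    case 0
    then show ?case
      by (simp add: c_def init_def reaches_refl)
  next
    case (Suc n)
    have "exec x (Write n 1) (c n) = c (Suc n)"
      by (auto simp: c_def init_def mark_def fun_eq_iff)
    moreover have "n < length P" "P ! n = Write n 1"
      using emb[of n "set_marks N" 0] Suc assms by (simp_all add: set_marks_def)
    moreover have "pc (c n) = n"
      by (simp add: c_def)
    ultimately have "reaches P x (c n) (c (Suc n))"
      by (intro reaches_exec[of "c n" _ "Write n 1"]) (simp_all add: reaches_refl del: exec.simps)
    then show ?case
      using Suc by (auto intro: reaches_trans)
  qed
  then show ?thesis
    by (intro exI[of _ "c N"]) (simp add: repr_def c_def init_def)
qed

section \<open>Growth of the output and parsing of unary blocks\<close>

lemma step_halted: "halted P c \<Longrightarrow> (step P x ^^ t) c = c"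
  by (induction t) (simp_all add: step_def)

lemma run_add: "run P p (t + s) = (step P (input_tape p) ^^ s) (run P p t)"
  by (simp add: run_def funpow_add add.commute[of t])

lemma run_halted: "halted P (run P p t) \<Longrightarrow> t \<le> s \<Longrightarrow> run P p s = run P p t"
  using run_add[of P p t "s - t"] by (simp add: step_halted)

lemma run_0 [simp]: "run P p 0 = init"
  by (simp add: run_def)

lemma run_Suc: "run P p (Suc t) = step P (input_tape p) (run P p t)"
  by (simp add: run_def)

lemma out_step: "out (step P x c) = out c \<or> (\<exists>b. out (step P x c) = out c @ [b])"
  by (cases "P ! pc c") (auto simp: step_def)

lemma out_run_mono:
  assumes "t \<le> s" shows "\<exists>v. out (run P p s) = out (run P p t) @ v"
  using assms
proof (induction s rule: dec_induct)
  case (step s)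
  then show ?case
    using out_step[of P "input_tape p" "run P p s"] by (auto simp: run_Suc)
qed simp

lemma unary_inject [simp]: "unary m = unary n \<longleftrightarrow> m = n"
proof
  assume "unary m = unary n"
  then have "length (unary m) = length (unary n)" by simp
  then show "m = n" by (simp add: unary_def)
qed simp

text \<open>Unary blocks form a prefix code: the number is the length of the leading run of
  ones.\<close>

lemma unary_append_cancel: "unary m @ u = unary n @ v \<longleftrightarrow> m = n \<and> u = v"
proof
  assume *: "unary m @ u = unary n @ v"
  have takeWhile: "takeWhile (\<lambda>b. b) (unary k @ w) = replicate k True" for k w
    by (simp add: unary_def takeWhile_append)
  have "replicate m True = replicate n True"
    using takeWhile[of m u] takeWhile[of n v] * by simp
  then have "m = n"
    by (metis length_replicate)
  then show "m = n \<and> u = v"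
    using * by simp
qed simp

text \<open>Parsing into blocks is unique, so an output made of complete blocks enumerates just
  their entries.\<close>

lemma unary_infix_iff:
  "(\<exists>ms v. concat (map unary xs) = concat (map unary ms) @ unary m @ v) \<longleftrightarrow> m \<in> set xs"
proof
  assume "\<exists>ms v. concat (map unary xs) = concat (map unary ms) @ unary m @ v"
  then obtain ms v where "concat (map unary xs) = concat (map unary ms) @ unary m @ v" by blast
  then show "m \<in> set xs"
  proof (induction ms arbitrary: xs)
    case Nil
    then show ?case
      by (cases xs) (auto simp: unary_append_cancel, simp add: unary_def)
  next
    case (Cons n ms)
    then show ?case
      by (cases xs) (auto simp: unary_append_cancel, simp add: unary_def)
  qed
next
  assume "m \<in> set xs"
  then obtain ys zs where "xs = ys @ m # zs"
    by (meson split_list)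
  then show "\<exists>ms v. concat (map unary xs) = concat (map unary ms) @ unary m @ v"
    by auto
qed

section \<open>Computing functions\<close>

text \<open>The graph of \<open>phi\<close> with an explicit time bound; it is monotone in the time
  and will be shown to be primitive recursive.\<close>

definition converges :: "nat \<Rightarrow> nat \<Rightarrow> nat \<Rightarrow> nat \<Rightarrow> bool" where
  "converges e n m t \<longleftrightarrow> halted (program e) (run (program e) (input_nat n) t) \<and>
     out (run (program e) (input_nat n) t) = unary m"

lemma converges_unique: "converges e n m t \<Longrightarrow> converges e n m' t' \<Longrightarrow> m = m'"
  unfolding converges_def by (metis nle_le run_halted unary_inject)

lemma converges_mono: "converges e n m t \<Longrightarrow> t \<le> s \<Longrightarrow> converges e n m s"
  unfolding converges_def by (metis run_halted)

lemma phi_eq_Some_iff: "phi e n = Some m \<longleftrightarrow> (\<exists>t. converges e n m t)"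
proof -
  have phi: "phi e n = (if \<exists>m t. converges e n m t then Some (THE m. \<exists>t. converges e n m t) else None)"
    by (simp add: phi_def converges_def Let_def)
  show ?thesis
  proof (cases "\<exists>m t. converges e n m t")
    case True
    then obtain m' t where t: "converges e n m' t" by blast
    then have "(THE m. \<exists>t. converges e n m t) = m'"
      using converges_unique by blast
    with True t show ?thesis
      using converges_unique phi by auto
  qed (use phi in simp)
qed

definition print :: "nat \<Rightarrow> com" where
  "print i = While i (Dec i ;; Out True) ;; Out False"

lemma exec_print: "exec_com p (print i) (r, k, w) (r(i := 0), k, w @ unary (r i))"
proof -
  have "exec_com p (While i (Dec i ;; Out True)) (r, k, w)
      (r(i := 0), k, w @ replicate (r i) True)"
  proof (induction "r i" arbitrary: r w)
    case 0
    then show ?case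
      using exec_com.While_end[of r i] by (metis append_Nil2 fun_upd_triv replicate_0)
  next
    case (Suc n)
    let ?r = "r(i := r i - 1)"
    have 1: "exec_com p (Dec i ;; Out True) (r, k, w) (?r, k, w @ [True])"
      by (intro exec_com.Seq[OF exec_com.Dec exec_com.Out])
    have "exec_com p (While i (Dec i ;; Out True)) (?r, k, w @ [True])
        (?r(i := 0), k, (w @ [True]) @ replicate (?r i) True)"
      using Suc(2)[symmetric] by (intro Suc.hyps(1)) simp
    moreover have "(w @ [True]) @ replicate (?r i) True = w @ replicate (r i) True"
      using Suc(2)[symmetric] by simp
    ultimately show ?case
      using exec_com.While_step[OF _ 1] Suc(2) by (metis Zero_not_Suc fun_upd_upd)
  qed
  from exec_com.Seq[OF this exec_com.Out[of p False]] show ?thesis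
    by (simp add: print_def unary_def)
qed

text \<open>Optional output: \<open>0\<close> stands for none and \<open>Suc m\<close> for
  \<open>m\<close>. \<open>Dec\<close> on value \<open>0\<close> serves as a skip.\<close>

definition print_pred :: "nat \<Rightarrow> com" where
  "print_pred i = Cond (Dec i ;; print i) i (Dec i)"

lemma exec_print_pred:
  "exec_com p (print_pred i) (r, k, w)
     (r(i := 0), k, w @ (if r i = 0 then [] else unary (r i - 1)))"
proof (cases "r i = 0")
  case True
  then show ?thesis
    unfolding print_pred_def using exec_com.Cond_zero[of r i, OF True exec_com.Dec[of p i r k w]] True
    by simp
next
  case False
  have "exec_com p (Dec i ;; print i) (r, k, w) (r(i := 0), k, w @ unary (r i - 1))"
    using exec_com.Seq[OF exec_com.Dec[of p i r k w] exec_print[of p i]] by simp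
  then show ?thesis
    unfolding print_pred_def using exec_com.Cond_nonzero[of r i, OF False] False by simp
qed

text \<open>Where \<open>g\<close> is \<open>0\<close>, the machine halts with empty output. This is
  not a unary numeral, so \<open>phi\<close> is undefined there although the machine stops.\<close>

lemma prim_rec_phi:
  assumes "prim_rec g"
  shows "\<exists>e. \<forall>n. phi e n = (if g n = 0 then None else Some (g n - 1))"
proof -
  obtain d where d: "computes d 0 g"
    using prim_rec_computes[OF assms] by blast
  define c where "c = Read 0 ;; d ;; print_pred 0"
  obtain N where N: "registers_below N c"
    using registers_below_ex by blast
  define P where "P = set_marks N @ compile N N c"
  obtain e where e: "program e = P"
    using surj_program by (metis surjD)
  have emb: "embedded P 0 (set_marks N)" "embedded P N (compile N N c)"
    using embedded_infix[of "[]" "set_marks N"] embedded_infix[of "set_marks N" "compile N N c" "[]"]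
    by (simp_all add: P_def)
  have fin: "\<exists>t. halted P (run P (input_nat n) t) \<and>
      out (run P (input_nat n) t) = (if g n = 0 then [] else unary (g n - 1))" for n
  proof -
    let ?r = "\<lambda>_::nat. 0::nat"
    have 1: "exec_com (input_nat n) (Read 0) (?r, 0, []) (?r(0 := n), 1, [])"
      using exec_com.Read[of "input_nat n" 0 ?r 0 "[]"] by (simp add: input_nat_def)
    have 2: "exec_com (input_nat n) d (?r(0 := n), 1, []) (?r(0 := g n), 1, [])"
      using d[unfolded computes_def, rule_format, of "?r(0 := n)"] by simp
    have "exec_com (input_nat n) c (?r, 0, []) (?r(0 := g n, 0 := 0), 1,
        [] @ (if g n = 0 then [] else unary (g n - 1)))"
      unfolding c_def
      using exec_com.Seq[OF 1 exec_com.Seq[OF 2 exec_print_pred[of _ 0]]] by (simp only: fun_upd_same)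
    then obtain r' k where
      "exec_com (input_nat n) c (?r, 0, []) (r', k, if g n = 0 then [] else unary (g n - 1))"
      by (metis append_Nil)
    moreover obtain c0 where c0: "reaches P (input_tape (input_nat n)) init c0"
      "repr (input_nat n) N (?r, 0, []) c0" "pc c0 = N"
      using reaches_set_marks[OF emb(1)] by blast
    ultimately obtain c1 where c1: "reaches P (input_tape (input_nat n)) c0 c1"
      "repr (input_nat n) N (r', k, if g n = 0 then [] else unary (g n - 1)) c1"
      "pc c1 = N + length (compile N N c)"
      using compile_correct[OF _ N emb(2)] by blast
    obtain t where "run P (input_nat n) t = c1"
      using reaches_trans[OF c0(1) c1(1)] unfolding reaches_def run_def by metis
    with c1 show ?thesis
      by (intro exI[of _ t]) (simp add: halted_def repr_def P_def)
  qed
  have "phi e n = (if g n = 0 then None else Some (g n - 1))" for n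
  proof -
    obtain t where t: "halted P (run P (input_nat n) t)"
      "out (run P (input_nat n) t) = (if g n = 0 then [] else unary (g n - 1))"
      using fin by blast
    have "converges e n m s \<Longrightarrow> unary m = (if g n = 0 then [] else unary (g n - 1))" for m s
      using t unfolding converges_def e by (metis nle_le run_halted)
    then have no: "g n = 0 \<Longrightarrow> \<not> converges e n m s" for m s
      by (fastforce simp: unary_def)
    show ?thesis
    proof (cases "g n = 0")
      case True
      then have "phi e n \<noteq> Some m" for m
        using no by (simp add: phi_eq_Some_iff)
      with True show ?thesis
        by (metis option.exhaust)
    next
      case False
      then have "converges e n (g n - 1) t"
        using t by (simp add: converges_def e)
      then show ?thesis
        using False phi_eq_Some_iff by auto
    qed
  qed
  then show ?thesis by blast
qed

lemma prim_rec_total_phi: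
  assumes "prim_rec g" shows "\<exists>e. \<forall>n. phi e n = Some (g n)"
  using prim_rec_phi[OF prim_rec_Suc[OF assms]] by simp

lemma ce_prim_rec:
  assumes "prim_rec_predicate P" shows "ce {n. P n}"
proof -
  obtain e where e: "\<And>n. phi e n = (if of_bool (P n) = (0::nat) then None else Some (of_bool (P n) - 1))"
    using prim_rec_phi[OF assms] by blast
  have "{n. P n} = dom (phi e)"
    by (auto simp: e dom_def split: if_splits)
  then show ?thesis
    unfolding ce_def by blast
qed

section \<open>Enumerating sets\<close>

text \<open>Endless repetition of a terminating command, with \<open>S n\<close> the state after
  \<open>n\<close> rounds. Output only grows, so its values at the starts of the rounds determine
  the enumerated set.\<close>

lemma enumerated_loop:
  assumes P: "P = set_marks N @ compile N N c @ [If_Work N 0 N]"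
    and N: "registers_below N c"
    and S0: "S 0 = (\<lambda>_. 0, 0, [])"
    and S: "\<And>n. exec_com p c (S n) (S (Suc n))"
  shows "enumerated P p = {m. \<exists>n ms v. snd (snd (S n)) = concat (map unary ms) @ unary m @ v}"
proof -
  have emb: "embedded P 0 (set_marks N)" "embedded P N (compile N N c)"
    using embedded_infix[of "[]" "set_marks N"]
      embedded_infix[of "set_marks N" "compile N N c" "[If_Work N 0 N]"]
    by (simp_all add: P)
  \<comment> \<open>Every round takes at least one step, its closing jump; hence some round starts
    after any given time.\<close>
  have times: "\<exists>t\<ge>n. repr p N (S n) (run P p t) \<and> pc (run P p t) = N" for n
  proof (induction n)
    case 0
    obtain c0 where c0: "reaches P (input_tape p) init c0" "repr p N (S 0) c0" "pc c0 = N"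
      using reaches_set_marks[OF emb(1)] unfolding S0 by blast
    then show ?case
      unfolding reaches_def run_def by auto
  next
    case (Suc n)
    then obtain t where t: "n \<le> t" "repr p N (S n) (run P p t)" "pc (run P p t) = N"
      by blast
    obtain c1 where c1: "reaches P (input_tape p) (run P p t) c1" "repr p N (S (Suc n)) c1"
      "pc c1 = N + length (compile N N c)"
      using compile_correct[OF S N emb(2) t(2,3)] by blast
    then obtain s where s: "c1 = run P p (t + s)"
      unfolding reaches_def run_add by blast
    have "P ! pc c1 = If_Work N 0 N"
      by (simp add: P c1(3) nth_append)
    moreover have "pc c1 < length P"
      by (simp add: P c1(3))
    moreover have "work c1 N = (\<lambda>_. 0)"
      using c1(2) by (simp add: repr_def)
    ultimately have "run P p (Suc (t + s)) = c1\<lparr>pc := N\<rparr>"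
      by (simp add: run_Suc s[symmetric] step_def halted_def)
    then have "repr p N (S (Suc n)) (run P p (Suc (t + s)))" "pc (run P p (Suc (t + s))) = N"
      using c1(2) by (simp_all add: repr_def)
    with t(1) show ?case
      by (intro exI[of _ "Suc (t + s)"]) simp
  qed
  show ?thesis
  proof (intro set_eqI iffI)
    fix m assume "m \<in> enumerated P p"
    then obtain t ms v where v: "out (run P p t) = concat (map unary ms) @ unary m @ v"
      by (auto simp: enumerated_def)
    obtain s where s: "t \<le> s" "out (run P p s) = snd (snd (S t))"
      using times[of t] by (auto simp: repr_def)
    obtain v' where "out (run P p s) = out (run P p t) @ v'"
      using out_run_mono[OF s(1)] by blast
    with v s have "snd (snd (S t)) = concat (map unary ms) @ unary m @ v @ v'"
      by simp
    then show "m \<in> {m. \<exists>n ms v. snd (snd (S n)) = concat (map unary ms) @ unary m @ v}"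
      by blast
  next
    fix m assume "m \<in> {m. \<exists>n ms v. snd (snd (S n)) = concat (map unary ms) @ unary m @ v}"
    then obtain n ms v where "snd (snd (S n)) = concat (map unary ms) @ unary m @ v"
      by blast
    moreover obtain t where "out (run P p t) = snd (snd (S n))"
      using times[of n] by (auto simp: repr_def)
    ultimately show "m \<in> enumerated P p"
      unfolding enumerated_def by auto
  qed
qed

text \<open>In each round the machine reads one more entry, applies \<open>g\<close> to the code of
  the prefix read so far, and prints the predecessor of a nonzero value.\<close>

lemma prim_rec_enumerated:
  assumes "prim_rec g"
  shows "\<exists>P. \<forall>p. enumerated P p = {m. \<exists>n. g (list_encode (map p [0..<Suc n])) = Suc m}"
proof -
  \<comment> \<open>Prepending a new entry takes only a pairing and an increment, so register
    \<open>0\<close> stores the prefix reversed; \<open>h\<close> undoes the reversal.\<close>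
  define h where "h l = g (list_encode (rev (list_decode l)))" for l
  have "prim_rec h"
    unfolding h_def by (intro prim_rec.comp[OF assms] prim_rec_rev prim_rec_id)
  then obtain d where d: "computes d 1 h"
    using prim_rec_computes by blast
  define c where "c = Read 1 ;; encode_pair 0 ;; Inc 0 ;; copy 0 ;; d ;; print_pred 1"
  obtain N where N: "registers_below N c"
    using registers_below_ex by blast
  define P where "P = set_marks N @ compile N N c @ [If_Work N 0 N]"
  have "enumerated P p = {m. \<exists>n. g (list_encode (map p [0..<Suc n])) = Suc m}" for p
  proof -
    let ?r = "\<lambda>_::nat. 0::nat"
    define L where "L n = list_encode (rev (map p [0..<n]))" for n
    define Y where "Y n = g (list_encode (map p [0..<Suc n]))" for n
    define ys where "ys n = concat (map (\<lambda>i. if Y i = 0 then [] else [Y i - 1]) [0..<n])" for n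
    define S where "S n = (?r(0 := L n), n, concat (map unary (ys n)))" for n
    have L_Suc: "L (Suc n) = Suc (prod_encode (p n, L n))" for n
      by (simp add: L_def)
    have h_L: "h (L (Suc n)) = Y n" for n
      by (simp add: h_def L_def Y_def)
    have step: "exec_com p c (S n) (S (Suc n))" for n
    proof -
      let ?w = "concat (map unary (ys n))"
      have 1: "exec_com p (Read 1) (S n) (?r(0 := L n, 1 := p n), Suc n, ?w)"
        using exec_com.Read[of p 1 "?r(0 := L n)" n ?w] by (simp add: S_def)
      have 2: "exec_com p (encode_pair 0) (?r(0 := L n, 1 := p n), Suc n, ?w)
          (?r(0 := prod_encode (p n, L n)), Suc n, ?w)"
        using exec_encode_pair[of 0 "?r(0 := L n, 1 := p n)" p "Suc n" ?w]
        by (simp add: fun_upd_twist fun_upd_idem)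
      have 3: "exec_com p (Inc 0) (?r(0 := prod_encode (p n, L n)), Suc n, ?w)
          (?r(0 := L (Suc n)), Suc n, ?w)"
        using exec_com.Inc[of p 0 "?r(0 := prod_encode (p n, L n))" "Suc n" ?w]
        by (simp add: L_Suc)
      have 4: "exec_com p (copy 0) (?r(0 := L (Suc n)), Suc n, ?w)
          (?r(0 := L (Suc n), 1 := L (Suc n)), Suc n, ?w)"
        using exec_copy[of 0 "?r(0 := L (Suc n))" p "Suc n" ?w] by simp
      have 5: "exec_com p d (?r(0 := L (Suc n), 1 := L (Suc n)), Suc n, ?w)
          (?r(0 := L (Suc n), 1 := Y n), Suc n, ?w)"
        using d[unfolded computes_def, rule_format,
            of "?r(0 := L (Suc n), 1 := L (Suc n))" p "Suc n" ?w] by (simp add: h_L)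
      have 6: "exec_com p (print_pred 1) (?r(0 := L (Suc n), 1 := Y n), Suc n, ?w) (S (Suc n))"
        using exec_print_pred[of p 1 "?r(0 := L (Suc n), 1 := Y n)" "Suc n" ?w]
        by (simp add: S_def ys_def fun_upd_twist fun_upd_idem split: if_splits)
      show ?thesis
        unfolding c_def
        by (rule exec_com.Seq[OF 1 exec_com.Seq[OF 2 exec_com.Seq[OF 3 exec_com.Seq[OF 4
                  exec_com.Seq[OF 5 6]]]]])
    qed
    have "S 0 = (\<lambda>_. 0, 0, [])"
      by (simp add: S_def L_def ys_def fun_upd_idem)
    then have "enumerated P p = {m. \<exists>n. m \<in> set (ys n)}"
      using enumerated_loop[OF P_def N, of S p] step by (simp add: S_def unary_infix_iff)
    also have "\<dots> = {m. \<exists>n. Y n = Suc m}"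
    proof -
      have "m \<in> set (ys n) \<longleftrightarrow> (\<exists>i<n. Y i = Suc m)" for m n
        by (force simp: ys_def)
      then show ?thesis by blast
    qed
    finally show ?thesis
      by (simp only: Y_def)
  qed
  then show ?thesis by blast
qed

text \<open>Normal form for the machines constructed below: a stage is read as a candidate
  \<open>m\<close> with a witness \<open>v\<close>, tested against the input read so far. Since
  \<open>v \<le> prod_encode (m, v)\<close>, a large witness ensures a long prefix.\<close>

lemma prim_rec_predicate_enumerated:
  assumes "prim_rec_predicate (\<lambda>z. R (p1 z) (p1 (p2 z)) (p2 (p2 z)))"
  shows "\<exists>P. \<forall>p. enumerated P p =
    {m. \<exists>v. R (list_encode (map p [0..<Suc (prod_encode (m, v))])) m v}"
proof -
  define g where "g l = (let n = length (list_decode l) - 1 in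
    if R l (p1 n) (p2 n) then Suc (p1 n) else 0)" for l
  have "prim_rec g"
    unfolding g_def Let_def
    by (intro prim_rec_comp3[of "\<lambda>a b c. of_bool (R a b c)", OF assms] prim_rec_logic prim_rec_length)
  then obtain P where P: "\<And>p. enumerated P p = {m. \<exists>n. g (list_encode (map p [0..<Suc n])) = Suc m}"
    using prim_rec_enumerated by meson
  have "g (list_encode (map p [0..<Suc n])) = Suc m \<longleftrightarrow>
      (\<exists>v. n = prod_encode (m, v) \<and> R (list_encode (map p [0..<Suc n])) m v)" for p n m
  proof -
    define l where "l = list_encode (map p [0..<Suc n])"
    obtain a b where n: "n = prod_encode (a, b)"
      by (metis prod_decode_inverse surj_pair)
    have "length (list_decode l) - 1 = n"
      by (simp add: l_def del: upt_Suc list_encode.simps)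
    then have "g l = (if R l a b then Suc a else 0)"
      by (simp add: g_def n)
    then show ?thesis
      unfolding l_def[symmetric] by (auto simp: n)
  qed
  then have "enumerated P p = {m. \<exists>v. R (list_encode (map p [0..<Suc (prod_encode (m, v))])) m v}" for p
    unfolding P by auto
  then show ?thesis by blast
qed

section \<open>Locality and output\<close>

lemma in_pos_run_le: "in_pos (run P p t) \<le> t"
proof (induction t)
  case (Suc t)
  have "in_pos (step P x c) \<le> Suc (in_pos c)" for x c
    by (cases "P ! pc c") (auto simp: step_def)
  with Suc show ?case
    by (simp add: run_Suc) (meson Suc_le_mono le_trans)
qed (simp add: init_def)

text \<open>Each block occupies at least one cell, so a separator at position \<open>n\<close> ends
  a block with index at most \<open>n\<close>. This yields both locality and primitive recursiveness
  of the tape.\<close>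

lemma input_tape_bounded: "input_tape p n \<longleftrightarrow> \<not> (\<exists>k<Suc n. Suc n = (\<Sum>i<Suc k. Suc (p i)))"
proof -
  have "k \<le> n" if "Suc n = (\<Sum>i<Suc k. Suc (p i))" for k
  proof -
    have "(\<Sum>i<Suc k. 1) \<le> (\<Sum>i<Suc k. Suc (p i))"
      by (intro sum_mono) simp
    with that show ?thesis by simp
  qed
  then show ?thesis
    unfolding input_tape_def by (metis less_Suc_eq_le lessThan_Suc_atMost)
qed

lemma input_tape_cong:
  assumes "\<And>i. i \<le> n \<Longrightarrow> p i = q i" shows "input_tape p n = input_tape q n"
proof -
  have "(\<Sum>i<Suc k. Suc (p i)) = (\<Sum>i<Suc k. Suc (q i))" if "k < Suc n" for k
    using assms that by (intro sum.cong) auto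
  then show ?thesis
    unfolding input_tape_bounded by metis
qed

lemma exec_cong: "x (in_pos c) = y (in_pos c) \<Longrightarrow> exec x I c = exec y I c"
  by (cases I) simp_all

text \<open>Before step \<open>t\<close> the head has reached position \<open>t - 1\<close> at most,
  and the symbol at position \<open>n\<close> depends only on the entries up to index
  \<open>n\<close>.\<close>

lemma run_cong:
  assumes "\<And>i. i < t \<Longrightarrow> p i = q i" shows "run P p t = run P q t"
  using assms
proof (induction t)
  case (Suc t)
  then have "run P p t = run P q t" by simp
  moreover have "input_tape p (in_pos (run P p t)) = input_tape q (in_pos (run P p t))"
    using Suc.prems in_pos_run_le[of P p t] by (intro input_tape_cong) simp
  ultimately show ?case
    unfolding run_Suc step_def by (metis exec_cong)
qed simp

section \<open>Completed blocks of the output\<close>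

definition emits :: "instr list \<Rightarrow> (nat \<Rightarrow> nat) \<Rightarrow> nat \<Rightarrow> nat \<Rightarrow> bool" where
  "emits P p t m \<longleftrightarrow> (\<exists>ms. out (run P p t) = concat (map unary ms) @ unary m)"

lemma emits_cong:
  assumes "\<And>i. i < t \<Longrightarrow> p i = q i" shows "emits P p t m = emits P q t m"
  using run_cong[OF assms] by (simp add: emits_def)

text \<open>A step writes at most one bit, so no prefix of the output is skipped.\<close>

lemma out_run_prefix:
  "out (run P p t) = u @ v \<Longrightarrow> \<exists>s. out (run P p s) = u"
proof (induction t arbitrary: v)
  case 0
  then show ?case
    by (intro exI[of _ 0]) (simp add: init_def)
next
  case (Suc t)
  consider "out (run P p (Suc t)) = out (run P p t)"
    | b where "out (run P p (Suc t)) = out (run P p t) @ [b]"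
    using out_step[of P "input_tape p" "run P p t"] by (auto simp: run_Suc)
  then show ?case
  proof cases
    case 1
    then show ?thesis
      using Suc by metis
  next
    case (2 b)
    show ?thesis
    proof (cases v rule: rev_exhaust)
      case Nil
      then show ?thesis
        using Suc.prems by auto
    next
      case (snoc v' b')
      then show ?thesis
        using Suc 2 by auto
    qed
  qed
qed

lemma enumerated_iff_emits: "m \<in> enumerated P p \<longleftrightarrow> (\<exists>t. emits P p t m)"
proof
  assume "m \<in> enumerated P p"
  then obtain t ms v where "out (run P p t) = (concat (map unary ms) @ unary m) @ v"
    by (auto simp: enumerated_def)
  then show "\<exists>t. emits P p t m"
    unfolding emits_def by (meson out_run_prefix)
next
  assume "\<exists>t. emits P p t m"
  then show "m \<in> enumerated P p"
    unfolding emits_def enumerated_def by (metis (mono_tags, lifting) append_Nil2 mem_Collect_eq)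
qed

text \<open>Cutting after every \<open>False\<close> makes each maximal run of ones, possibly empty,
  a block together with its separator.\<close>

lemma concat_unary_ex: "u = [] \<or> \<not> last u \<Longrightarrow> \<exists>ms. u = concat (map unary ms)"
proof (induction u rule: length_induct)
  case (1 u)
  show ?case
  proof (cases "u = []")
    case True
    then show ?thesis
      by (intro exI[of _ "[]"]) simp
  next
    case False
    define v where "v = dropWhile (\<lambda>b. b) u"
    have u: "u = replicate (length (takeWhile (\<lambda>b. b) u)) True @ v"
      by (metis (mono_tags, lifting) replicate_eqI set_takeWhileD takeWhile_dropWhile_id v_def)
    have "v \<noteq> []"
      using False 1 unfolding v_def by (metis dropWhile_eq_Nil_conv last_in_set)
    then have v: "v = False # tl v"
      unfolding v_def by (metis hd_dropWhile list.collapse)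
    have "length (tl v) < length u"
      using u v by (metis append_eq_append_conv2 length_append length_Cons less_Suc_eq_le
          linorder_not_le not_add_less2)
    moreover have "tl v = [] \<or> \<not> last (tl v)"
      using False 1 u v by (metis last_ConsR last_appendR list.distinct(1))
    ultimately obtain ms where "tl v = concat (map unary ms)"
      using 1 by blast
    then have "u = concat (map unary (length (takeWhile (\<lambda>b. b) u) # ms))"
      using u v by (simp add: unary_def)
    then show ?thesis ..
  qed
qed

text \<open>The last block is read off the reversed output. The condition on \<open>u\<close>
  excludes that the ones belong to a longer block.\<close>

lemma emits_iff:
  "emits P p t m \<longleftrightarrow> (\<exists>u. rev (out (run P p t)) = False # replicate m True @ u \<and> (u = [] \<or> \<not> hd u))"
proof
  assume "emits P p t m"
  then obtain ms where "out (run P p t) = concat (map unary ms) @ unary m"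
    by (auto simp: emits_def)
  moreover have "concat (map unary ms) = [] \<or> \<not> last (concat (map unary ms))"
    by (cases ms rule: rev_exhaust) (simp_all add: unary_def)
  ultimately show "\<exists>u. rev (out (run P p t)) = False # replicate m True @ u \<and> (u = [] \<or> \<not> hd u)"
    by (intro exI[of _ "rev (concat (map unary ms))"]) (auto simp: unary_def hd_rev)
next
  assume "\<exists>u. rev (out (run P p t)) = False # replicate m True @ u \<and> (u = [] \<or> \<not> hd u)"
  then obtain u where u: "rev (out (run P p t)) = False # replicate m True @ u" "u = [] \<or> \<not> hd u"
    by blast
  obtain ms where ms: "rev u = concat (map unary ms)"
    using concat_unary_ex[of "rev u"] u(2) by (auto simp: last_rev)
  have "out (run P p t) = rev (False # replicate m True @ u)"
    using u(1) by (metis rev_rev_ident)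
  then show "emits P p t m"
    using ms by (auto simp: emits_def unary_def)
qed

section \<open>Simulation of machines\<close>

text \<open>The accumulator is \<open>0\<close> until the key is found and the value plus one
  afterwards, so the first entry wins; the final subtraction also produces the default
  \<open>0\<close>.\<close>

definition code_lookup :: "nat \<Rightarrow> nat \<Rightarrow> nat" where
  "code_lookup l k =
     foldl (\<lambda>a y. if a \<noteq> 0 then a else if p1 y = k then Suc (p2 y) else 0) 0 (list_decode l) - 1"

lemma code_lookup_0 [simp]: "code_lookup 0 k = 0"
  by (simp add: code_lookup_def)

lemma code_lookup_cons [simp]:
  "code_lookup (code_cons (prod_encode (k', v)) l) k = (if k' = k then v else code_lookup l k)"
proof -
  have "foldl (\<lambda>a y. if a \<noteq> 0 then a else if p1 y = k then Suc (p2 y) else 0) (Suc b) xs = Suc b"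
    for b xs
    by (induction xs) simp_all
  then show ?thesis
    by (simp add: code_lookup_def)
qed

lemma prim_rec_code_lookup:
  "prim_rec f \<Longrightarrow> prim_rec g \<Longrightarrow> prim_rec (\<lambda>x. code_lookup (f x) (g x))"
  unfolding code_lookup_def
  by (intro prim_rec_minus_1 prim_rec_foldl prim_rec_logic)
     (auto intro: prim_rec.comp[of g, OF _ prim_rec.fst])

text \<open>\<open>int_encode\<close> sends \<open>z \<ge> 0\<close> to \<open>2 z\<close> and
  \<open>z < 0\<close> to \<open>- 2 z - 1\<close>. Truncated subtraction takes \<open>1\<close>,
  the code of \<open>-1\<close>, to \<open>0\<close>.\<close>

definition code_int_inc :: "nat \<Rightarrow> nat" where
  "code_int_inc n = (if even n then Suc (Suc n) else n - 1 - 1)"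

definition code_int_dec :: "nat \<Rightarrow> nat" where
  "code_int_dec n = (if n = 0 then 1 else if even n then n - 1 - 1 else Suc (Suc n))"

lemma code_int_inc [simp]: "code_int_inc (int_encode z) = int_encode (z + 1)"
proof (cases "z \<ge> 0")
  case False
  then show ?thesis
    by (cases "z = -1") (auto simp: code_int_inc_def int_encode_def sum_encode_def nat_diff_distrib)
qed (simp add: code_int_inc_def int_encode_def sum_encode_def nat_add_distrib)

lemma code_int_dec [simp]: "code_int_dec (int_encode z) = int_encode (z - 1)"
proof (cases "z \<ge> 0")
  case False
  then have "nat (- z) = Suc (nat (- z - 1))"
    by simp
  with False show ?thesis
    by (simp add: code_int_dec_def int_encode_def sum_encode_def)
next
  case True
  then show ?thesis
    by (cases "z = 0") (auto simp: code_int_dec_def int_encode_def sum_encode_def nat_diff_distrib)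
qed

lemma prim_rec_code_int_inc: "prim_rec f \<Longrightarrow> prim_rec (\<lambda>x. code_int_inc (f x))"
  unfolding code_int_inc_def by (intro prim_rec_logic prim_rec_even)

lemma prim_rec_code_int_dec: "prim_rec f \<Longrightarrow> prim_rec (\<lambda>x. code_int_dec (f x))"
  unfolding code_int_dec_def by (intro prim_rec_logic prim_rec_even)

text \<open>Configurations are coded as \<open>(pc, in_pos, heads, work tapes, reversed output)\<close>, where heads
  and work tapes are association lists with default value \<open>0\<close>.\<close>

abbreviation c_pc :: "nat \<Rightarrow> nat" where "c_pc c \<equiv> p1 c"
abbreviation c_in :: "nat \<Rightarrow> nat" where "c_in c \<equiv> p1 (p2 c)"
abbreviation c_head :: "nat \<Rightarrow> nat" where "c_head c \<equiv> p1 (p2 (p2 c))"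
abbreviation c_work :: "nat \<Rightarrow> nat" where "c_work c \<equiv> p1 (p2 (p2 (p2 c)))"
abbreviation c_out :: "nat \<Rightarrow> nat" where "c_out c \<equiv> p2 (p2 (p2 (p2 c)))"

definition represents :: "nat \<Rightarrow> config \<Rightarrow> bool" where
  "represents c cfg \<longleftrightarrow> c_pc c = pc cfg \<and> c_in c = in_pos cfg \<and>
     (\<forall>i. code_lookup (c_head c) i = int_encode (head cfg i)) \<and>
     (\<forall>i z. code_lookup (c_work c) (prod_encode (i, int_encode z)) = work cfg i z) \<and>
     c_out c = list_encode (map of_bool (rev (out cfg)))"

text \<open>Follows the case distinction of \<open>decode_instr\<close> on the code \<open>d\<close>
  of an instruction, with \<open>b\<close> as the scanned input bit.\<close>

definition code_exec :: "nat \<Rightarrow> nat \<Rightarrow> nat \<Rightarrow> nat" where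
  "code_exec b d c = (let k = p1 d; i = p1 (p2 d); s = p1 (p2 (p2 d)); l = p2 (p2 (p2 d));
       h = code_lookup (c_head c) i in
     prod_encode (
       if k = 1 \<and> b \<noteq> 0 \<or> k = 5 \<and> code_lookup (c_work c) (prod_encode (i, h)) = s then l
       else Suc (c_pc c), prod_encode (
       if k = 0 then Suc (c_in c) else c_in c, prod_encode (
       if k = 2 then code_cons (prod_encode (i, code_int_dec h)) (c_head c)
       else if k = 3 then code_cons (prod_encode (i, code_int_inc h)) (c_head c)
       else c_head c, prod_encode (
       if k = 4 then code_cons (prod_encode (prod_encode (i, h), s)) (c_work c) else c_work c,
       if 5 < k then code_cons (of_bool (s \<noteq> 0)) (c_out c) else c_out c)))))"

lemma represents_exec:
  assumes "represents c cfg"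
  shows "represents (code_exec (of_bool (x (in_pos cfg))) d c) (exec x (decode_instr d) cfg)"
proof -
  obtain k i s l where d: "prod_decode d = (k, prod_encode (i, prod_encode (s, l)))"
    by (metis prod_decode_inverse surj_pair)
  consider "k = 0" | "k = 1" | "k = 2" | "k = 3" | "k = 4" | "k = 5" | "k > 5"
    by linarith
  then show ?thesis
    using assms
    by cases (auto simp: d decode_instr_def code_exec_def represents_def Let_def
        int_encode_eq prod_encode_eq)
qed

lemma prim_rec_code_exec:
  "prim_rec f \<Longrightarrow> prim_rec g \<Longrightarrow> prim_rec h \<Longrightarrow> prim_rec (\<lambda>x. code_exec (f x) (g x) (h x))"
  unfolding code_exec_def Let_def
  by (intro prim_rec_logic prim_rec_code_lookup prim_rec_code_cons prim_rec_code_int_inc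
      prim_rec_code_int_dec)

text \<open>The input sequence is given by a finite list \<open>q\<close>, continued by \<open>0\<close>.\<close>

definition code_step :: "nat \<Rightarrow> nat \<Rightarrow> nat \<Rightarrow> nat" where
  "code_step e q c = (if code_drop (c_pc c) e = 0 then c
     else code_exec (of_bool (input_tape (code_nth q) (c_in c))) (code_nth e (c_pc c)) c)"

text \<open>\<open>0\<close> codes the initial configuration: all its components are
  \<open>0\<close>, and lookup in the empty list gives \<open>0\<close>, which is also the code of
  head position \<open>0\<close>.\<close>

definition code_run :: "nat \<Rightarrow> nat \<Rightarrow> nat \<Rightarrow> nat" where
  "code_run e q t = (code_step e q ^^ t) 0"

lemma halted_program: "halted (program e) cfg \<longleftrightarrow> code_drop (pc cfg) e = 0"
  by (simp add: halted_def program_def code_drop_eq_0)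

lemma represents_code_run: "represents (code_run e q t) (run (program e) (code_nth q) t)"
proof (induction t)
  case 0
  have "int_encode 0 = 0"
    by (simp add: int_encode_def sum_encode_def)
  then show ?case
    by (simp add: code_run_def represents_def init_def)
next
  case (Suc t)
  let ?c = "code_run e q t" and ?cfg = "run (program e) (code_nth q) t"
  have eq: "c_pc ?c = pc ?cfg" "c_in ?c = in_pos ?cfg"
    using Suc by (simp_all add: represents_def)
  have run: "code_run e q (Suc t) = code_step e q ?c"
    by (simp add: code_run_def)
  show ?case
  proof (cases "halted (program e) ?cfg")
    case True
    then have "code_drop (pc ?cfg) e = 0"
      by (simp add: halted_program)
    then have "code_step e q ?c = ?c"
      by (simp add: code_step_def eq)
    with True Suc show ?thesis
      by (simp add: run run_Suc step_def)
  next
    case False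
    then have "program e ! pc ?cfg = decode_instr (code_nth e (pc ?cfg))"
      by (simp add: halted_def program_def code_nth_list_decode)
    with False show ?thesis
      using represents_exec[OF Suc, of "input_tape (code_nth q)" "code_nth e (pc ?cfg)"]
      by (simp add: run run_Suc step_def code_step_def eq halted_program)
  qed
qed

lemma prim_rec_input_tape:
  assumes "prim_rec f" "prim_rec g"
  shows "prim_rec_predicate (\<lambda>x. input_tape (code_nth (f x)) (g x))"
proof -
  have "prim_rec_predicate (\<lambda>z. input_tape (code_nth (p1 z)) (p2 z))"
    unfolding input_tape_bounded
    by (intro prim_rec_logic prim_rec_sum prim_rec_code_nth)
  from prim_rec_comp2[of "\<lambda>a b. of_bool (input_tape (code_nth a) b)", OF this assms]
  show ?thesis .
qed

lemma prim_rec_code_step: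
  "prim_rec f \<Longrightarrow> prim_rec g \<Longrightarrow> prim_rec h \<Longrightarrow> prim_rec (\<lambda>x. code_step (f x) (g x) (h x))"
  unfolding code_step_def
  by (intro prim_rec_logic prim_rec_code_exec prim_rec_input_tape prim_rec_code_drop
      prim_rec_code_nth)

lemma prim_rec_code_run:
  assumes "prim_rec f" "prim_rec g" "prim_rec h"
  shows "prim_rec (\<lambda>x. code_run (f x) (g x) (h x))"
proof -
  have "prim_rec (\<lambda>z. code_run (p1 z) (p1 (p2 z)) (p2 (p2 z)))"
    unfolding code_run_def
    by (intro prim_rec_funpow prim_rec_code_step prim_rec_basic)
  from prim_rec_comp3[OF this assms] show ?thesis .
qed

lemma c_out_code_run:
  "c_out (code_run e q t) = list_encode (map of_bool (rev (out (run (program e) (code_nth q) t))))"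
  using represents_code_run[of e q t] by (simp add: represents_def)

section \<open>Primitive recursiveness of timed convergence and output\<close>

lemma of_bool_map_inject: "map (of_bool :: bool \<Rightarrow> nat) xs = map of_bool ys \<longleftrightarrow> xs = ys"
  by (rule inj_map_eq_map) (auto simp: inj_def)

definition code_ones :: "nat \<Rightarrow> nat \<Rightarrow> nat" where
  "code_ones m l = (code_cons 1 ^^ m) l"

lemma code_ones_list_encode: "code_ones m (list_encode xs) = list_encode (replicate m 1 @ xs)"
  by (induction m) (simp_all add: code_ones_def)

lemma prim_rec_code_ones:
  "prim_rec f \<Longrightarrow> prim_rec g \<Longrightarrow> prim_rec (\<lambda>x. code_ones (f x) (g x))"
  unfolding code_ones_def by (intro prim_rec_funpow prim_rec_code_cons prim_rec_basic)

lemma input_nat_eq: "input_nat n = code_nth (code_cons n 0)"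
  by (auto simp: fun_eq_iff input_nat_def code_nth_list_decode split: nat.splits)

lemma converges_code:
  "converges e n m t \<longleftrightarrow> (let c = code_run e (code_cons n 0) t in
     code_drop (c_pc c) e = 0 \<and> c_out c = code_cons 0 (code_ones m 0))"
proof -
  let ?o = "out (run (program e) (code_nth (code_cons n 0)) t)"
  have "c_pc (code_run e (code_cons n 0) t) = pc (run (program e) (code_nth (code_cons n 0)) t)"
    using represents_code_run[of e "code_cons n 0" t] by (simp add: represents_def)
  moreover have "c_out (code_run e (code_cons n 0) t) = code_cons 0 (code_ones m 0) \<longleftrightarrow>
      ?o = unary m"
  proof -
    have "code_cons 0 (code_ones m 0) = list_encode (map of_bool (rev (unary m)))"
      using code_ones_list_encode[of m "[]"] by (simp add: unary_def del: list_encode.simps(2))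
    then show ?thesis
      by (simp add: c_out_code_run list_encode_eq of_bool_map_inject del: list_encode.simps)
  qed
  ultimately show ?thesis
    unfolding converges_def input_nat_eq halted_program Let_def by simp
qed

lemma prim_rec_converges:
  assumes "prim_rec e" "prim_rec n" "prim_rec m" "prim_rec t"
  shows "prim_rec_predicate (\<lambda>x. converges (e x) (n x) (m x) (t x))"
  unfolding converges_code Let_def
  by (intro prim_rec_logic prim_rec_code_run prim_rec_code_drop prim_rec_code_cons
      prim_rec_code_ones assms)

text \<open>The only candidate for \<open>u\<close> in \<open>emits_iff\<close> is the reversed
  output without its first \<open>m + 1\<close> bits, so the quantifier disappears. The default
  \<open>0\<close> of \<open>code_nth\<close> covers the case of empty \<open>u\<close>.\<close>

lemma emits_code:
  "emits (program e) (code_nth q) t m \<longleftrightarrow> (let l = c_out (code_run e q t); u = code_drop (Suc m) l in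
     l = code_cons 0 (code_ones m u) \<and> code_nth u 0 = 0)"
proof -
  let ?o = "rev (out (run (program e) (code_nth q) t))"
  let ?u = "drop (Suc m) ?o"
  have l: "c_out (code_run e q t) = list_encode (map of_bool ?o)"
    by (rule c_out_code_run)
  have u: "code_drop (Suc m) (c_out (code_run e q t)) = list_encode (map of_bool ?u)"
    unfolding l code_drop_list_encode by (simp add: drop_map)
  have "code_cons 0 (code_ones m (list_encode (map of_bool ?u))) =
      list_encode (map of_bool (False # replicate m True @ ?u))"
    by (simp add: code_ones_list_encode del: list_encode.simps)
  then have 1: "c_out (code_run e q t) = code_cons 0 (code_ones m (list_encode (map of_bool ?u))) \<longleftrightarrow>
      ?o = False # replicate m True @ ?u"
    by (simp only: l list_encode_eq of_bool_map_inject)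
  have 2: "code_nth (list_encode (map of_bool ?u)) 0 = 0 \<longleftrightarrow> ?u = [] \<or> \<not> hd ?u"
    by (cases ?u) (simp_all add: code_nth_list_encode del: list_encode.simps)
  have "emits (program e) (code_nth q) t m \<longleftrightarrow>
      ?o = False # replicate m True @ ?u \<and> (?u = [] \<or> \<not> hd ?u)"
    unfolding emits_iff
    by (smt (verit) append_eq_conv_conj drop_Suc_Cons length_replicate)
  then show ?thesis
    unfolding Let_def u 1 2 .
qed

lemma prim_rec_emits:
  assumes "prim_rec q" "prim_rec t" "prim_rec m"
  shows "prim_rec_predicate (\<lambda>x. emits (program e) (code_nth (q x)) (t x) (m x))"
  unfolding emits_code Let_def
  by (intro prim_rec_logic prim_rec_code_run prim_rec_code_drop prim_rec_code_cons
      prim_rec_code_ones prim_rec_code_nth assms)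

section \<open>Names\<close>

lemma set_decode_less: "x \<in> set_decode n \<Longrightarrow> x < n"
proof -
  assume "x \<in> set_decode n"
  then have "n div 2 ^ x \<noteq> 0"
    unfolding set_decode_def by (metis even_zero mem_Collect_eq)
  then have "2 ^ x \<le> n"
    by (metis div_less not_le)
  then show ?thesis
    using less_exp[of x] by linarith
qed

lemma set_decode_singleton: "set_decode (set_encode {x}) = {x}"
  by (rule set_encode_inverse) simp

section \<open>Finite parts of Type-2 names\<close>

text \<open>A finite part of a name says only that some finite sets lie in the named set, so it fits
  every set containing them. The filler \<open>0\<close> codes the empty set.\<close>

lemma type2_name_extend:
  assumes "\<And>i. i < t \<Longrightarrow> set_decode (p i) \<subseteq> E"
  shows "\<exists>q. type2_name q E \<and> (\<forall>i<t. q i = p i)"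
proof -
  define q where "q i = (if i < t then p i else if set_decode (i - t) \<subseteq> E then i - t else 0)" for i
  have "j \<in> range q" if "set_decode j \<subseteq> E" for j
    using that by (intro range_eqI[of _ _ "j + t"]) (simp add: q_def)
  moreover have "set_decode (q i) \<subseteq> E" for i
    using assms by (simp add: q_def)
  ultimately have "type2_name q E"
    unfolding type2_name_def by blast
  then show ?thesis
    by (intro exI[of _ q]) (simp add: q_def)
qed

lemma type2_name_subset: "type2_name p E \<Longrightarrow> set_decode (p i) \<subseteq> E"
  unfolding type2_name_def by blast

lemma type2_name_member:
  assumes "type2_name p E" "x \<in> E" shows "\<exists>i. x \<in> set_decode (p i)"
proof -
  have "set_encode {x} \<in> range p"
    unfolding assms(1)[unfolded type2_name_def] mem_Collect_eq set_decode_singleton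
    using assms(2) by simp
  then obtain i where "set_encode {x} = p i"
    by blast
  then show ?thesis
    using set_decode_singleton by (metis singletonI)
qed

lemma enumerated_local:
  assumes "m \<in> enumerated P p"
  shows "\<exists>t. \<forall>q. (\<forall>i<t. q i = p i) \<longrightarrow> m \<in> enumerated P q"
  using assms emits_cong unfolding enumerated_iff_emits by metis

section \<open>Markov names and the complexity of c.e. sets\<close>

text \<open>\<open>g\<close> reads its argument as a finite set, a list of claimed values and a
  time, and returns the set if all its elements are thereby verified to lie in the domain; otherwise
  it returns \<open>0\<close>, the code of the empty set.\<close>

lemma ce_markov_name:
  assumes "ce E" shows "\<exists>e. markov_name e E"
proof -
  obtain e where e: "E = dom (phi e)"
    using assms ce_def by blast
  define g where "g n = (if \<forall>x<p1 n. x \<in> set_decode (p1 n) \<longrightarrow>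
    converges e x (code_nth (p1 (p2 n)) x) (p2 (p2 n)) then p1 n else 0)" for n
  have "prim_rec g"
    unfolding g_def
    by (intro prim_rec_logic prim_rec_converges prim_rec_code_nth prim_rec_set_decode)
  then obtain e' where e': "\<And>n. phi e' n = Some (g n)"
    using prim_rec_total_phi by blast
  have "set_decode (g n) \<subseteq> E" for n
    using set_decode_less by (auto simp: g_def e dom_def phi_eq_Some_iff) blast
  moreover have "i \<in> range g" if i: "set_decode i \<subseteq> E" for i
  proof -
    have "\<forall>x\<in>set_decode i. \<exists>m t. converges e x m t"
      using i by (auto simp: e dom_def phi_eq_Some_iff)
    then obtain m t where mt: "\<And>x. x \<in> set_decode i \<Longrightarrow> converges e x (m x) (t x)"
      by metis
    \<comment> \<open>The sum of the halting times is a common time bound for all elements.\<close>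
    let ?T = "\<Sum>x\<in>set_decode i. t x"
    have "converges e x (m x) ?T" if "x \<in> set_decode i" for x
      using mt[OF that] converges_mono member_le_sum[OF that, of t] by auto
    then have "g (prod_encode (i, prod_encode (list_encode (map m [0..<i]), ?T))) = i"
      by (simp add: g_def code_nth_list_encode)
    then show ?thesis
      by (metis rangeI)
  qed
  ultimately have "type2_name g E"
    unfolding type2_name_def by blast
  then show ?thesis
    unfolding markov_name_def using e' by blast
qed

lemma K_le: "markov_name e E \<Longrightarrow> K E \<le> program_length e"
  unfolding K_def by (rule Least_le) blast

text \<open>Some Markov name exists, so the minimum that defines \<open>K\<close> is
  attained.\<close>

lemma markov_name_le_K:
  assumes "ce E" shows "\<exists>e. markov_name e E \<and> program_length e = K E"
  unfolding K_def using LeastI_ex[of "\<lambda>k. \<exists>e. markov_name e E \<and> k = program_length e"]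
    ce_markov_name[OF assms] by metis

text \<open>Lets an index serve as the complexity bound in a K-name.\<close>

lemma program_length_le: "program_length e \<le> e"
proof -
  have "2 ^ floor_log (Suc e) \<le> Suc e"
    by (rule floor_log_exp2_le) simp
  then show ?thesis
    unfolding program_length_def using less_exp[of "floor_log (Suc e)"] by linarith
qed

text \<open>An explicit bound on the finitely many programs of length at most \<open>k\<close>, so
  that a machine can go through all of them.\<close>

lemma less_program_length: "program_length e \<le> k \<Longrightarrow> e < 2 ^ Suc k"
proof -
  assume *: "program_length e \<le> k"
  have "Suc e < 2 * 2 ^ floor_log (Suc e)"
    by (rule floor_log_exp2_gt)
  also have "\<dots> \<le> 2 * 2 ^ k"
    using * by (simp add: program_length_def)
  finally show ?thesis by simp
qed

section \<open>Comparison of the representations\<close>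

lemma code_nth_prefix: "i < n \<Longrightarrow> code_nth (list_encode (map p [0..<n])) i = p i"
  by (simp add: code_nth_list_encode)

lemma code_nth_code_tl: "code_nth (code_tl q) i = code_nth q (Suc i)"
  by (simp add: code_nth_def code_drop_def funpow_swap1)

lemma code_nth_code_cons: "code_nth (code_cons x q) = case_nat x (code_nth q)"
  by (auto simp: fun_eq_iff code_nth_list_decode split: nat.splits)

text \<open>The given machine is simulated on the tail of the input, with the complexity bound
  dropped.\<close>

lemma type2_imp_K_computable:
  assumes "type2_computable F" shows "K_computable F"
proof -
  obtain P where P: "\<And>E p. ce E \<Longrightarrow> type2_name p E \<Longrightarrow> outputs_open_name P p (F E)"
    using assms unfolding type2_computable_def by blast
  obtain a where a: "P = program a"
    using surj_program by (metis surjD)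
  define R where "R q m t \<longleftrightarrow> emits (program a) (code_nth (code_tl q)) t m" for q m t
  have "prim_rec_predicate (\<lambda>z. R (p1 z) (p1 (p2 z)) (p2 (p2 z)))"
    unfolding R_def by (intro prim_rec_emits prim_rec_code_tl prim_rec_basic)
  then obtain Q where Q: "\<And>p. enumerated Q p =
      {m. \<exists>t. R (list_encode (map p [0..<Suc (prod_encode (m, t))])) m t}"
    using prim_rec_predicate_enumerated by meson
  \<comment> \<open>By \<open>t \<le> prod_encode (m, t)\<close>, the tail of the prefix contains
    all entries that \<open>t\<close> steps can depend on.\<close>
  have "R (list_encode (map (case_nat k p) [0..<Suc (prod_encode (m, t))])) m t \<longleftrightarrow> emits P p t m"
    for k p m t
    unfolding R_def a
    by (intro emits_cong)
       (use le_prod_encode_2[of t m] in \<open>simp add: code_nth_code_tl code_nth_prefix del: upt_Suc\<close>)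
  then have "enumerated Q (case_nat k p) = enumerated P p" for k p
    unfolding Q set_eq_iff enumerated_iff_emits by blast
  with P have "\<forall>E k p. ce E \<longrightarrow> K_name (k, p) E \<longrightarrow> outputs_open_name Q (case_nat k p) (F E)"
    by (simp add: K_name_def outputs_open_name_def)
  then show ?thesis
    unfolding K_computable_def by blast
qed

text \<open>A Markov name \<open>e\<close> yields the K-name consisting of \<open>e\<close> itself,
  as \<open>K E \<le> program_length e \<le> e\<close>, and of the values of
  \<open>phi e\<close>.\<close>

lemma K_imp_markov_computable:
  assumes "K_computable F" shows "markov_computable F"
proof -
  obtain P where P: "\<And>E k p. ce E \<Longrightarrow> K_name (k, p) E \<Longrightarrow> outputs_open_name P (case_nat k p) (F E)"
    using assms unfolding K_computable_def by blast
  obtain a where a: "P = program a"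
    using surj_program by (metis surjD)
  \<comment> \<open>\<open>w\<close> codes a time \<open>t\<close> for the computations of
    \<open>phi\<close>, a number \<open>s\<close> of steps of \<open>P\<close>, and a list
    \<open>v\<close> whose first \<open>s\<close> entries are checked to be values of the
    name.\<close>
  define R where "R q m w \<longleftrightarrow>
    (\<forall>i<p1 (p2 w). converges (code_nth q 0) i (code_nth (p2 (p2 w)) i) (p1 w)) \<and>
    emits (program a) (code_nth (code_cons (code_nth q 0) (p2 (p2 w)))) (p1 (p2 w)) m" for q m w
  have "prim_rec_predicate (\<lambda>z. R (p1 z) (p1 (p2 z)) (p2 (p2 z)))"
    unfolding R_def
    by (intro prim_rec_emits prim_rec_code_cons prim_rec_code_nth prim_rec_converges prim_rec_logic)
  then obtain Q where Q: "\<And>p. enumerated Q p =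
      {m. \<exists>w. R (list_encode (map p [0..<Suc (prod_encode (m, w))])) m w}"
    using prim_rec_predicate_enumerated by meson
  have "outputs_open_name Q (input_nat e) (F E)" if E: "ce E" "markov_name e E" for E e
  proof -
    obtain p where p: "\<And>n. phi e n = Some (p n)" "type2_name p E"
      using E(2) unfolding markov_name_def by blast
    have "K E \<le> e"
      using K_le[OF E(2)] program_length_le le_trans by blast
    then have "outputs_open_name P (case_nat e p) (F E)"
      using P E(1) p(2) by (simp add: K_name_def)
    moreover have "enumerated Q (input_nat e) = enumerated P (case_nat e p)"
    proof (intro set_eqI iffI)
      fix m assume "m \<in> enumerated Q (input_nat e)"
      then obtain w where w: "R (list_encode (map (input_nat e) [0..<Suc (prod_encode (m, w))])) m w"
        unfolding Q by blast
      obtain t s v where w_eq: "w = prod_encode (t, prod_encode (s, v))"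
        by (metis prod_decode_inverse surj_pair)
      have conv: "\<forall>i<s. converges e i (code_nth v i) t"
        and emits: "emits P (case_nat e (code_nth v)) s m"
        using w unfolding R_def w_eq
        by (simp_all add: code_nth_prefix input_nat_def code_nth_code_cons a del: upt_Suc)
      have "i < s \<Longrightarrow> code_nth v i = p i" for i
        using conv p(1) by (metis option.inject phi_eq_Some_iff)
      then have "emits P (case_nat e p) s m"
        using emits emits_cong[of s "case_nat e (code_nth v)" "case_nat e p"]
        by (auto split: nat.splits)
      then show "m \<in> enumerated P (case_nat e p)"
        unfolding enumerated_iff_emits by blast
    next
      fix m assume "m \<in> enumerated P (case_nat e p)"
      then obtain s where s: "emits P (case_nat e p) s m"
        unfolding enumerated_iff_emits by blast
      have "\<forall>i. \<exists>t. converges e i (p i) t"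
        using p(1) by (simp add: phi_eq_Some_iff)
      then obtain T where T: "\<And>i. converges e i (p i) (T i)"
        by metis
      define v where "v = list_encode (map p [0..<s])"
      define t where "t = (\<Sum>i<s. T i)"
      have v: "i < s \<Longrightarrow> code_nth v i = p i" for i
        by (simp add: v_def code_nth_prefix)
      have "converges e i (code_nth v i) t" if "i < s" for i
        using converges_mono[OF T] v[OF that] member_le_sum[of i "{..<s}" T] that
        by (simp add: t_def)
      moreover have "emits P (case_nat e (code_nth v)) s m"
        using s v emits_cong[of s "case_nat e (code_nth v)" "case_nat e p"]
        by (auto split: nat.splits)
      ultimately have "R (list_encode (map (input_nat e) [0..<Suc n])) m
          (prod_encode (t, prod_encode (s, v)))" for n
        unfolding R_def
        by (simp add: code_nth_prefix input_nat_def code_nth_code_cons a del: upt_Suc)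
      then show "m \<in> enumerated Q (input_nat e)"
        unfolding Q by blast
    qed
    ultimately show ?thesis
      by (simp add: outputs_open_name_def)
  qed
  then show ?thesis
    unfolding markov_computable_def by blast
qed

section \<open>Cylinders and open sets\<close>

lemma open_cylinder: "open (cylinder u)"
proof -
  have "cylinder u = (\<Inter>i<length u. (\<lambda>f. f i) -` {u ! i})"
    by (auto simp: cylinder_def)
  moreover have "open ((\<lambda>f::nat \<Rightarrow> nat. f i) -` {u ! i})" for i
    by (intro open_vimage open_discrete continuous_on_product_coordinates)
  ultimately show ?thesis
    by (simp add: open_INT)
qed

lemma outputs_open_name_imp_open: "outputs_open_name P p U \<Longrightarrow> open U"
  unfolding outputs_open_name_def using open_cylinder by blast

lemma cylinder_code:
  "f \<in> cylinder (list_decode u) \<longleftrightarrow> (\<forall>i<length (list_decode u). f i = code_nth u i)"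
  by (simp add: cylinder_def code_nth_list_decode)

lemma prefix_cylinder: "f \<in> cylinder (list_decode (list_encode (map f [0..<n])))"
  by (simp add: cylinder_def)

section \<open>Markov-computable but not K-computable\<close>

text \<open>\<open>s\<close> codes an argument, a value and a time, so that evidence is sought over
  a single number. The notion makes sense for every program, whether or not it computes a
  name.\<close>

definition evidence :: "nat \<Rightarrow> nat \<Rightarrow> nat \<Rightarrow> bool" where
  "evidence e x s \<longleftrightarrow> converges e (p1 s) (p1 (p2 s)) (p2 (p2 s)) \<and> x \<in> set_decode (p1 (p2 s))"

lemma evidence_iff:
  assumes "markov_name e E" shows "(\<exists>s. evidence e x s) \<longleftrightarrow> x \<in> E"
proof -
  obtain p where p: "\<And>n. phi e n = Some (p n)" "type2_name p E"
    using assms unfolding markov_name_def by blast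
  show ?thesis
  proof
    assume "\<exists>s. evidence e x s"
    then obtain n m t where "converges e n m t" "x \<in> set_decode m"
      unfolding evidence_def by blast
    then have "p n = m"
      using p(1) by (metis option.inject phi_eq_Some_iff)
    then show "x \<in> E"
      using type2_name_subset[OF p(2), of n] \<open>x \<in> set_decode m\<close> by blast
  next
    assume "x \<in> E"
    then obtain n where n: "x \<in> set_decode (p n)"
      using type2_name_member[OF p(2)] by blast
    obtain t where "converges e n (p n) t"
      using p(1) phi_eq_Some_iff by blast
    with n show "\<exists>s. evidence e x s"
      by (intro exI[of _ "prod_encode (n, prod_encode (p n, t))"]) (simp add: evidence_def)
  qed
qed

lemma prim_rec_evidence:
  "prim_rec e \<Longrightarrow> prim_rec x \<Longrightarrow> prim_rec s \<Longrightarrow> prim_rec_predicate (\<lambda>z. evidence (e z) (x z) (s z))"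
  unfolding evidence_def by (intro prim_rec_converges prim_rec_set_decode prim_rec_logic)

text \<open>What \<open>f e\<close> bounds, inclusively, is the code of some evidence rather than a
  bare running time.\<close>

definition zero_bounds :: "(nat \<Rightarrow> nat) set" where
  "zero_bounds = {f. \<forall>e. (\<exists>s. evidence e 0 s) \<longrightarrow> (\<exists>s<Suc (f e). evidence e 0 s)}"

text \<open>The decidable half of a violation of \<open>zero_bounds\<close> at \<open>e\<close>,
  read off a prefix just long enough to contain position \<open>e\<close>; the other half is that
  evidence exists at all.\<close>

definition late :: "nat \<Rightarrow> nat \<Rightarrow> bool" where
  "late e u \<longleftrightarrow> length (list_decode u) = Suc e \<and> (\<forall>s<Suc (code_nth u e). \<not> evidence e 0 s)"

lemma late_cylinder:
  assumes "late e u" "f \<in> cylinder (list_decode u)" "evidence e 0 s" shows "f \<notin> zero_bounds"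
proof -
  have "f e = code_nth u e"
    using assms by (simp add: late_def cylinder_code)
  with assms show ?thesis
    unfolding late_def zero_bounds_def by auto
qed

lemma late_prefix:
  "late e (list_encode (map f [0..<Suc e])) \<longleftrightarrow> (\<forall>s<Suc (f e). \<not> evidence e 0 s)"
  by (simp add: late_def code_nth_prefix del: upt_Suc)

definition zero_test :: "nat set \<Rightarrow> (nat \<Rightarrow> nat) set" where
  "zero_test E = (if 0 \<in> E then - zero_bounds else UNIV)"

text \<open>Prefixes late for \<open>e\<close> itself are listed at once: they cover everything if
  \<open>0 \<notin> E\<close>, and avoid \<open>zero_bounds\<close> otherwise. The rest of the
  complement is listed only after evidence for \<open>0 \<in> E\<close>.\<close>

lemma markov_computable_zero_test: "markov_computable zero_test"
proof -
  define R where "R q u w \<longleftrightarrow> late (code_nth q 0) u \<or>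
    evidence (code_nth q 0) 0 (p1 w) \<and> evidence (p1 (p2 w)) 0 (p2 (p2 w)) \<and> late (p1 (p2 w)) u"
    for q u w
  have "prim_rec_predicate (\<lambda>z. R (p1 z) (p1 (p2 z)) (p2 (p2 z)))"
    unfolding R_def late_def
    by (intro prim_rec_logic prim_rec_evidence prim_rec_code_nth prim_rec_length)
  then obtain Q where Q: "\<And>p. enumerated Q p =
      {m. \<exists>w. R (list_encode (map p [0..<Suc (prod_encode (m, w))])) m w}"
    using prim_rec_predicate_enumerated by meson
  have "outputs_open_name Q (input_nat e) (zero_test E)" if e: "markov_name e E" for E e
  proof -
    have enum: "u \<in> enumerated Q (input_nat e) \<longleftrightarrow> late e u \<or>
        0 \<in> E \<and> (\<exists>e' s. evidence e' 0 s \<and> late e' u)" for u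
    proof -
      have "u \<in> enumerated Q (input_nat e) \<longleftrightarrow> (\<exists>w. late e u \<or>
          evidence e 0 (p1 w) \<and> evidence (p1 (p2 w)) 0 (p2 (p2 w)) \<and> late (p1 (p2 w)) u)"
        unfolding Q R_def by (simp add: code_nth_prefix input_nat_def del: upt_Suc)
      also have "\<dots> \<longleftrightarrow> late e u \<or>
          (\<exists>s e' s'. evidence e 0 s \<and> evidence e' 0 s' \<and> late e' u)"
        by (metis prod_encode_inverse fst_conv snd_conv)
      finally show ?thesis
        unfolding evidence_iff[OF e, symmetric] by blast
    qed
    have "f \<in> zero_test E \<longleftrightarrow> (\<exists>u\<in>enumerated Q (input_nat e). f \<in> cylinder (list_decode u))" for f
    proof
      assume f: "f \<in> zero_test E"
      obtain e' where "list_encode (map f [0..<Suc e']) \<in> enumerated Q (input_nat e)"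
      proof (cases "0 \<in> E")
        case True
        then obtain e' s where "evidence e' 0 s" "\<forall>s<Suc (f e'). \<not> evidence e' 0 s"
          using f by (auto simp: zero_test_def zero_bounds_def)
        then show ?thesis
          using True by (intro that[of e']) (auto simp: enum late_prefix simp del: upt_Suc)
      next
        case False
        \<comment> \<open>Program \<open>e\<close> never shows \<open>0\<close>, so every prefix of
          length \<open>e + 1\<close> is late for it.\<close>
        then have "\<not> evidence e 0 s" for s
          using evidence_iff[OF e] by blast
        then show ?thesis
          by (intro that[of e]) (simp add: enum late_prefix del: upt_Suc)
      qed
      then show "\<exists>u\<in>enumerated Q (input_nat e). f \<in> cylinder (list_decode u)"
        using prefix_cylinder by blast
    next
      assume "\<exists>u\<in>enumerated Q (input_nat e). f \<in> cylinder (list_decode u)"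
      then obtain u where u: "u \<in> enumerated Q (input_nat e)" "f \<in> cylinder (list_decode u)"
        by blast
      show "f \<in> zero_test E"
      proof (cases "0 \<in> E")
        case True
        then obtain e' s where "evidence e' 0 s" "late e' u"
          using u(1) evidence_iff[OF e] unfolding enum by blast
        then show ?thesis
          using late_cylinder u(2) True by (simp add: zero_test_def)
      qed (simp add: zero_test_def)
    qed
    then show ?thesis
      unfolding outputs_open_name_def by blast
  qed
  then show ?thesis
    unfolding markov_computable_def by blast
qed

lemma zero_bounds_nonempty: "zero_bounds \<noteq> {}"
proof -
  have "(\<lambda>e. SOME s. evidence e 0 s) \<in> zero_bounds"
    unfolding zero_bounds_def mem_Collect_eq by (meson lessI someI_ex)
  then show ?thesis by blast
qed

lemma ce_lessThan: "ce {..<n}"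
  using ce_prim_rec[OF prim_rec_less[OF prim_rec_id prim_rec_const]] by (simp add: lessThan_def)

lemma ce_UNIV: "ce UNIV"
  using ce_prim_rec[of "\<lambda>_. True"] prim_rec_const by simp

text \<open>A point of \<open>zero_bounds\<close> is accepted for the empty set after finitely many
  entries of the constant name \<open>0\<close>, and these can be continued to a name of
  \<open>{0}\<close>.\<close>

lemma not_K_computable_zero_test: "\<not> K_computable zero_test"
proof
  assume "K_computable zero_test"
  then obtain P where P:
    "\<And>E k p. ce E \<Longrightarrow> K_name (k, p) E \<Longrightarrow> outputs_open_name P (case_nat k p) (zero_test E)"
    unfolding K_computable_def by blast
  obtain f where f: "f \<in> zero_bounds"
    using zero_bounds_nonempty by blast
  \<comment> \<open>A common complexity bound for the empty set and \<open>{0}\<close>, so that the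
    first input entry does not distinguish them.\<close>
  define k where "k = max (K {..<0}) (K {..<1})"
  have "type2_name (\<lambda>_. 0) {..<0}"
  proof -
    have "i = 0" if "set_decode i = {}" for i
      using arg_cong[OF that, of set_encode] by simp
    then show ?thesis
      by (auto simp: type2_name_def)
  qed
  then have "outputs_open_name P (case_nat k (\<lambda>_. 0)) (zero_test {..<0})"
    by (intro P ce_lessThan) (simp add: K_name_def k_def)
  moreover have "f \<in> zero_test {..<0}"
    by (simp add: zero_test_def)
  ultimately obtain u where u: "u \<in> enumerated P (case_nat k (\<lambda>_. 0))" "f \<in> cylinder (list_decode u)"
    unfolding outputs_open_name_def by blast
  obtain t where t: "\<And>q. (\<forall>i<t. q i = case_nat k (\<lambda>_. 0) i) \<Longrightarrow> u \<in> enumerated P q"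
    using enumerated_local[OF u(1)] by blast
  obtain q where q: "type2_name q {..<1}" "\<forall>i<t. q i = 0"
    using type2_name_extend[of t "\<lambda>_. 0" "{..<1}"] by auto
  have "u \<in> enumerated P (case_nat k q)"
    using q(2) by (intro t) (auto split: nat.splits)
  moreover have "outputs_open_name P (case_nat k q) (zero_test {..<1})"
    using q(1) by (intro P ce_lessThan) (simp add: K_name_def k_def)
  ultimately have "f \<in> zero_test {..<1}"
    using u(2) unfolding outputs_open_name_def by blast
  with f show False
    by (simp add: zero_test_def)
qed

section \<open>K-computable but not Type-2-computable\<close>

text \<open>The witnesses \<open>f (e, n + 1)\<close> make this set closed with a c.e. complement; mere bounds for the
  least missing elements would not do.\<close>

definition gap_oracles :: "(nat \<Rightarrow> nat) set" where
  "gap_oracles = {f. \<forall>e n. if f (prod_encode (e, 0)) = 0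
     then evidence e n (f (prod_encode (e, Suc n)))
     else \<not> evidence e (f (prod_encode (e, 0)) - 1) n}"

lemma gap_oraclesD:
  assumes "f \<in> gap_oracles"
  shows "f (prod_encode (e, 0)) = 0 \<Longrightarrow> evidence e n (f (prod_encode (e, Suc n)))"
    and "f (prod_encode (e, 0)) \<noteq> 0 \<Longrightarrow> \<not> evidence e (f (prod_encode (e, 0)) - 1) n"
  using assms unfolding gap_oracles_def by (metis (mono_tags, lifting) mem_Collect_eq)+

lemma gap_oracles_nonempty: "gap_oracles \<noteq> {}"
proof -
  \<comment> \<open>The value \<open>0\<close> is reserved for the claim that all numbers appear,
    hence the successor of the missing number.\<close>
  define g where "g e j = (case j of
      0 \<Rightarrow> if \<forall>x. \<exists>s. evidence e x s then 0 else Suc (SOME x. \<forall>s. \<not> evidence e x s)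
    | Suc n \<Rightarrow> SOME s. evidence e n s)" for e j
  have "(\<forall>s. \<not> evidence e (SOME x. \<forall>s. \<not> evidence e x s) s)" if "\<not> (\<forall>x. \<exists>s. evidence e x s)" for e
    using that someI_ex[of "\<lambda>x. \<forall>s. \<not> evidence e x s"] by blast
  then have "(\<lambda>z. g (p1 z) (p2 z)) \<in> gap_oracles"
    unfolding gap_oracles_def by (auto simp: g_def intro: someI_ex)
  then show ?thesis by blast
qed

text \<open>Requiring both positions to lie inside \<open>u\<close> keeps the default value of
  \<open>code_nth\<close> from being mistaken for a value of \<open>f\<close>.\<close>

definition refuted :: "nat \<Rightarrow> nat \<Rightarrow> nat \<Rightarrow> bool" where
  "refuted u e n \<longleftrightarrow> prod_encode (e, 0) < length (list_decode u) \<and>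
     prod_encode (e, Suc n) < length (list_decode u) \<and>
     (code_nth u (prod_encode (e, 0)) = 0 \<and> \<not> evidence e n (code_nth u (prod_encode (e, Suc n))) \<or>
      code_nth u (prod_encode (e, 0)) \<noteq> 0 \<and> evidence e (code_nth u (prod_encode (e, 0)) - 1) n)"

text \<open>Each condition on \<open>f\<close> inspects two positions, so a violation already shows
  in a finite prefix and can be enumerated.\<close>

lemma not_gap_oracle_iff:
  "f \<notin> gap_oracles \<longleftrightarrow> (\<exists>u e n. refuted u e n \<and> f \<in> cylinder (list_decode u))"
proof
  assume "f \<notin> gap_oracles"
  then obtain e n where en: "\<not> (if f (prod_encode (e, 0)) = 0
     then evidence e n (f (prod_encode (e, Suc n)))
     else \<not> evidence e (f (prod_encode (e, 0)) - 1) n)"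
    unfolding gap_oracles_def by blast
  let ?u = "list_encode (map f [0..<Suc (prod_encode (e, 0) + prod_encode (e, Suc n))])"
  have "refuted ?u e n"
    using en by (auto simp: refuted_def code_nth_prefix simp del: upt_Suc split: if_splits)
  then show "\<exists>u e n. refuted u e n \<and> f \<in> cylinder (list_decode u)"
    using prefix_cylinder by blast
next
  assume "\<exists>u e n. refuted u e n \<and> f \<in> cylinder (list_decode u)"
  then obtain u e n where u: "refuted u e n" "f \<in> cylinder (list_decode u)"
    by blast
  then have "f (prod_encode (e, 0)) = code_nth u (prod_encode (e, 0))"
    "f (prod_encode (e, Suc n)) = code_nth u (prod_encode (e, Suc n))"
    by (simp_all add: refuted_def cylinder_code)
  with u(1) show "f \<notin> gap_oracles"
    unfolding refuted_def by (metis gap_oraclesD)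
qed

definition full_test :: "nat set \<Rightarrow> (nat \<Rightarrow> nat) set" where
  "full_test E = (if E = UNIV then UNIV else - gap_oracles)"

text \<open>The sum of finitely many witnesses bounds each of them, so one more than the sum serves
  as \<open>w\<close>.\<close>

lemma bounded_choice:
  assumes "\<And>e. e < (n::nat) \<Longrightarrow> \<exists>i::nat. A e i" shows "\<exists>w. \<forall>e<n. \<exists>i<w. A e i"
proof -
  obtain h where h: "\<And>e. e < n \<Longrightarrow> A e (h e)"
    using assms by metis
  have "h e < Suc (\<Sum>e<n. h e)" if "e < n" for e
    using member_le_sum[of e "{..<n}" h] that by simp
  with h show ?thesis
    by blast
qed

text \<open>If \<open>E\<close> is not everything, some program of length at most \<open>k\<close>
  names it, and a gap oracle must claim for this program a number outside \<open>E\<close>. That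
  claim never gets refuted by a name of \<open>E\<close>, so nothing in \<open>gap_oracles\<close>
  is accepted.\<close>

lemma K_computable_full_test: "K_computable full_test"
proof -
  \<comment> \<open>\<open>2 ^ Suc k\<close> exceeds all programs of length at most
    \<open>k\<close>. Entry \<open>0\<close> of the input is \<open>k\<close> itself, so the name
    starts at \<open>Suc i\<close>.\<close>
  define certified where "certified q u w \<longleftrightarrow> (\<forall>e<2 ^ Suc (code_nth q 0).
    prod_encode (e, 0) < length (list_decode u) \<and> (code_nth u (prod_encode (e, 0)) = 0 \<or>
      (\<exists>i<w. code_nth u (prod_encode (e, 0)) - 1 \<in> set_decode (code_nth q (Suc i)))))" for q u w
  define R where "R q u w \<longleftrightarrow> refuted u (p1 w) (p2 w) \<or> certified q u w" for q u w
  have "prim_rec_predicate (\<lambda>z. R (p1 z) (p1 (p2 z)) (p2 (p2 z)))"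
    unfolding R_def certified_def refuted_def
    by (intro prim_rec_logic prim_rec_evidence prim_rec_code_nth prim_rec_length prim_rec_power2
        prim_rec_set_decode)
  then obtain Q where Q: "\<And>p. enumerated Q p =
      {m. \<exists>w. R (list_encode (map p [0..<Suc (prod_encode (m, w))])) m w}"
    using prim_rec_predicate_enumerated by meson
  have "outputs_open_name Q (case_nat k p) (full_test E)"
    if E: "ce E" and name: "K_name (k, p) E" for E k p
  proof -
    have p: "type2_name p E" and k: "K E \<le> k"
      using name by (simp_all add: K_name_def)
    define C where "C f w \<longleftrightarrow> (\<forall>e<2 ^ Suc k. f (prod_encode (e, 0)) = 0 \<or>
      (\<exists>i<w. f (prod_encode (e, 0)) - 1 \<in> set_decode (p i)))" for f :: "nat \<Rightarrow> nat" and w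
    have cert: "certified (list_encode (map (case_nat k p) [0..<Suc (prod_encode (u, w))])) u w \<longleftrightarrow>
        (\<forall>e<2 ^ Suc k. prod_encode (e, 0) < length (list_decode u)) \<and> C (code_nth u) w" for u w
    proof -
      have "i < w \<Longrightarrow> Suc i < Suc (prod_encode (u, w))" for i
        using le_prod_encode_2[of w u] by simp
      then show ?thesis
        unfolding certified_def C_def
        by (auto simp: code_nth_prefix simp del: upt_Suc power_Suc)
    qed
    have enum: "u \<in> enumerated Q (case_nat k p) \<longleftrightarrow> (\<exists>e n. refuted u e n) \<or>
        (\<forall>e<2 ^ Suc k. prod_encode (e, 0) < length (list_decode u)) \<and> (\<exists>w. C (code_nth u) w)" for u
    proof -
      have "u \<in> enumerated Q (case_nat k p) \<longleftrightarrow> (\<exists>w. refuted u (p1 w) (p2 w) \<or>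
        (\<forall>e<2 ^ Suc k. prod_encode (e, 0) < length (list_decode u)) \<and> C (code_nth u) w)"
        unfolding Q R_def cert by blast
      moreover have "(\<exists>w. refuted u (p1 w) (p2 w)) \<longleftrightarrow> (\<exists>e n. refuted u e n)"
        by (metis prod_encode_inverse fst_conv snd_conv)
      ultimately show ?thesis
        by blast
    qed
    \<comment> \<open>The refuted prefixes are enumerated for every \<open>E\<close>, so the
      complement of \<open>gap_oracles\<close> is always covered.\<close>
    have sub: "f \<in> - gap_oracles \<Longrightarrow> \<exists>u\<in>enumerated Q (case_nat k p). f \<in> cylinder (list_decode u)"
      for f
      using not_gap_oracle_iff enum by blast
    show ?thesis
    proof (cases "E = UNIV")
      case True
      have "\<exists>u\<in>enumerated Q (case_nat k p). f \<in> cylinder (list_decode u)" for f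
      proof -
        obtain l where "\<forall>e<2 ^ Suc k. \<exists>i<l. i = prod_encode (e, 0)"
          using bounded_choice[of "2 ^ Suc k" "\<lambda>e i. i = prod_encode (e, 0)"] by blast
        then have l: "\<forall>e<2 ^ Suc k. prod_encode (e, 0) < l"
          by blast
        \<comment> \<open>Every number occurs in a name of the full set, so finitely many claims are
          refuted by a common stage \<open>w\<close>.\<close>
        obtain w where "\<forall>e<2 ^ Suc k. \<exists>i<w. f (prod_encode (e, 0)) - 1 \<in> set_decode (p i)"
          using bounded_choice[of "2 ^ Suc k" "\<lambda>e i. f (prod_encode (e, 0)) - 1 \<in> set_decode (p i)"]
            type2_name_member[OF p] True by blast
        then have "C (code_nth (list_encode (map f [0..<l]))) w"
          unfolding C_def using l by (simp add: code_nth_prefix)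
        then have "list_encode (map f [0..<l]) \<in> enumerated Q (case_nat k p)"
          unfolding enum using l by auto
        then show ?thesis
          using prefix_cylinder by blast
      qed
      then show ?thesis
        unfolding outputs_open_name_def full_test_def True by auto
    next
      case False
      have "f \<notin> gap_oracles" if u: "u \<in> enumerated Q (case_nat k p)" "f \<in> cylinder (list_decode u)"
        for f u
      proof
        assume f: "f \<in> gap_oracles"
        then have len: "\<forall>e<2 ^ Suc k. prod_encode (e, 0) < length (list_decode u)"
          and "\<exists>w. C (code_nth u) w"
          using u not_gap_oracle_iff unfolding enum by blast+
        then obtain w where w: "C (code_nth u) w" by blast
        obtain e where e: "markov_name e E" "program_length e = K E"
          using markov_name_le_K[OF E] by blast
        then have e_less: "e < 2 ^ Suc k"
          using less_program_length k by simp
        then have eq: "f (prod_encode (e, 0)) = code_nth u (prod_encode (e, 0))"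
          using len u(2) by (simp add: cylinder_code)
        show False
        proof (cases "f (prod_encode (e, 0)) = 0")
          case True
          \<comment> \<open>The claim of fullness comes with evidence for each \<open>n\<close>,
            which would make \<open>E\<close> the full set.\<close>
          then have "evidence e n (f (prod_encode (e, Suc n)))" for n
            using f gap_oraclesD(1) by blast
          then show False
            using evidence_iff[OF e(1)] False by blast
        next
          case nonzero: False
          then obtain i where "f (prod_encode (e, 0)) - 1 \<in> set_decode (p i)"
            using w e_less eq unfolding C_def by auto
          then have "f (prod_encode (e, 0)) - 1 \<in> E"
            using type2_name_subset[OF p] by blast
          then obtain s where "evidence e (f (prod_encode (e, 0)) - 1) s"
            using evidence_iff[OF e(1)] by blast
          then show False
            using f nonzero gap_oraclesD(2) by blast
        qed
      qed
      then show ?thesis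
        unfolding outputs_open_name_def full_test_def using False sub by auto
    qed
  qed
  then show ?thesis
    unfolding K_computable_def by blast
qed

text \<open>The identity names the full set. Its first \<open>t\<close> entries code subsets of
  \<open>{..<t}\<close>, so a finite computation accepting a gap oracle also accepts it for the
  proper subset \<open>{..<t}\<close>.\<close>

lemma not_type2_computable_full_test: "\<not> type2_computable full_test"
proof
  assume "type2_computable full_test"
  then obtain P where P: "\<And>E p. ce E \<Longrightarrow> type2_name p E \<Longrightarrow> outputs_open_name P p (full_test E)"
    unfolding type2_computable_def by blast
  obtain f where f: "f \<in> gap_oracles"
    using gap_oracles_nonempty by blast
  have "outputs_open_name P (\<lambda>i. i) (full_test UNIV)"
    by (intro P ce_UNIV) (simp add: type2_name_def)
  moreover have "f \<in> full_test UNIV"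
    by (simp add: full_test_def)
  ultimately obtain u where u: "u \<in> enumerated P (\<lambda>i. i)" "f \<in> cylinder (list_decode u)"
    unfolding outputs_open_name_def by blast
  obtain t where t: "\<And>q. (\<forall>i<t. q i = i) \<Longrightarrow> u \<in> enumerated P q"
    using enumerated_local[OF u(1)] by blast
  have "set_decode i \<subseteq> {..<t}" if "i < t" for i
    using set_decode_less that by fastforce
  then obtain q where q: "type2_name q {..<t}" "\<forall>i<t. q i = i"
    using type2_name_extend[of t "\<lambda>i. i" "{..<t}"] by auto
  have "outputs_open_name P q (full_test {..<t})"
    by (intro P ce_lessThan q)
  then have "f \<in> full_test {..<t}"
    using t[OF q(2)] u(2) unfolding outputs_open_name_def by blast
  moreover have "{..<t} \<noteq> UNIV"
    by (metis lessThan_iff UNIV_I less_irrefl)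
  ultimately show False
    using f by (simp add: full_test_def)
qed

text \<open>Every c.e. set has a Markov name, and whatever the machine outputs on it names a union
  of cylinders. With K-computable implying Markov-computable, this covers both examples.\<close>

lemma markov_computable_open:
  assumes "markov_computable F" shows "F \<in> {E. ce E} \<rightarrow> {U. open U}"
  using assms ce_markov_name outputs_open_name_imp_open unfolding markov_computable_def by blast

theorem mainTheorem16:
  shows "(\<forall>F \<in> {E. ce E} \<rightarrow> {U. open U}. type2_computable F \<longrightarrow> K_computable F) \<and>
    (\<forall>F \<in> {E. ce E} \<rightarrow> {U. open U}. K_computable F \<longrightarrow> markov_computable F) \<and>
    (\<exists>F \<in> {E. ce E} \<rightarrow> {U. open U}. markov_computable F \<and> \<not> K_computable F) \<and>
    (\<exists>F \<in> {E. ce E} \<rightarrow> {U. open U}. K_computable F \<and> \<not> type2_computable F)"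
  using type2_imp_K_computable K_imp_markov_computable markov_computable_open
    markov_computable_zero_test not_K_computable_zero_test
    K_computable_full_test not_type2_computable_full_test
  by blast

end
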